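(* The capacity of the EC-OIC is lower-bounded as $$\mathsf{C}_{\mathrm E}(\mathbf{h},\boldsymbol{\alpha},\sigma)\ge\frac12\log\left(1+\frac{\exp(2\gamma_{\mathrm E})}{2\pi e\sigma^2}\right),$$ where $$\gamma_{\mathrm E}=\min_{\substack{\nu_0,\lambda_0\in\mathbb{R}\\ \lambda_1,\dots,\lambda_{n-1}\ge0}}\ \sum_{i=0}^{n-1}\lambda_i(1-\mathsf{H}_{[i]})\bar\alpha_i-1-\nu_0+e^{\nu_0}\left\{\sum_{k=1}^n h_k\exp\left[-\lambda_0\mathsf{H}_{[k-1]}+\sum_{i=1}^{k-2}\lambda_i\big(\mathsf{H}_{[i]}-\mathsf{H}_{[k-1]}\big)\right]\zeta\left[\left(-\sum_{i=0}^{k-1}\lambda_i\right)h_k\right]\right\}$$ with $\zeta(x)=\frac{e^x-1}{x}$ (and $\zeta(0)=1$).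
   Context: Let $n\ge 2$ be an integer, $\mathbf{h}=(h_1,\dots,h_n)^{\mathsf T}$ with $h_k>0$ and $\sum_{k=1}^n h_k=1$, and $\boldsymbol{\alpha}=(\alpha_1,\dots,\alpha_n)^{\mathsf T}$ with $1\ge\alpha_1>\alpha_2>\cdots>\alpha_n>0$ and $\alpha_n\le \tfrac12$. Put $\mathsf{H}_{[0]}=0$, $\mathsf{H}_{[k]}=\sum_{i=1}^k h_i$ and $\bar\alpha_k=\frac{\sum_{i=k+1}^n h_i\alpha_i}{1-\mathsf{H}_{[k]}}$ for $0\le k\le n-1$. Empty sums are $0$. Channel: $Y=\mathbf{h}^{\mathsf T}\mathbf{X}+Z$ with $Z\sim\mathcal{N}(0,\sigma^2)$, $\sigma>0$, independent of $\mathbf{X}=(X_1,\dots,X_n)^{\mathsf T}$. The EC-OIC capacity is $\mathsf{C}_{\mathrm E}(\mathbf{h},\boldsymbol{\alpha},\sigma)=\sup I(\mathbf{X};Y)$, the supremum being over all laws of $\mathbf{X}$ with $0\le X_k\le1$ (almost surely) and $\mathbb{E}[X_k]=\alpha_k$ for all $k\in\{1,\dots,n\}$. $I$ is mutual information in nats; $\log$ is the natural logarithm.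
   Formalization: The minimum defining γ_E is read as an infimum; it is shown to be attained when α_1 < 1, while for α_1 = 1 no minimizer exists and the capacity bound is stated with the infimum. *)

theory Defs
  imports "HOL-Probability.Probability"
begin

text \<open>Vectors indexed by \<open>1, \<dots>, n\<close> are functions on \<^typ>\<open>nat\<close> that matter only on \<open>{1..n}\<close>.\<close>

definition cumH :: "(nat \<Rightarrow> real) \<Rightarrow> nat \<Rightarrow> real" where
  "cumH h k = (\<Sum>i=1..k. h i)"

definition alpha_bar :: "nat \<Rightarrow> (nat \<Rightarrow> real) \<Rightarrow> (nat \<Rightarrow> real) \<Rightarrow> nat \<Rightarrow> real" where
  "alpha_bar n h \<alpha> k = (\<Sum>i=k+1..n. h i * \<alpha> i) / (1 - cumH h k)"

text \<open>The expectations are well defined: the first condition makes every coordinate bounded.\<close>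

definition input_laws :: "nat \<Rightarrow> (nat \<Rightarrow> real) \<Rightarrow> (nat \<Rightarrow> real) measure set" where
  "input_laws n \<alpha> =
    {P. prob_space P \<and> sets P = sets (\<Pi>\<^sub>M k\<in>{1..n}. (borel :: real measure)) \<and>
        (\<forall>k\<in>{1..n}. (AE x in P. 0 \<le> x k \<and> x k \<le> 1) \<and> (\<integral>x. x k \<partial>P) = \<alpha> k)}"

definition channel_space :: "real \<Rightarrow> (nat \<Rightarrow> real) measure \<Rightarrow> ((nat \<Rightarrow> real) \<times> real) measure" where
  "channel_space \<sigma> P = P \<Otimes>\<^sub>M density lborel (\<lambda>z. ennreal (normal_density 0 \<sigma> z))"

definition channel_output :: "nat \<Rightarrow> (nat \<Rightarrow> real) \<Rightarrow> (nat \<Rightarrow> real) \<times> real \<Rightarrow> real" where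
  "channel_output n h = (\<lambda>(x, z). (\<Sum>k=1..n. h k * x k) + z)"

text \<open>
  Logarithms to base \<open>exp 1\<close>, i.e. nats. The library's mutual information is a real-valued
  Bochner integral, with value 0 for a non-integrable information density. This does not occur
  here: for \<open>P \<in> input_laws n \<alpha>\<close> the noiseless output lies in a bounded interval, so the
  information density of the pair exists and is dominated by a quadratic polynomial in the noise.
\<close>

definition channel_information :: "nat \<Rightarrow> (nat \<Rightarrow> real) \<Rightarrow> real \<Rightarrow> (nat \<Rightarrow> real) measure \<Rightarrow> real" where
  "channel_information n h \<sigma> P =
    prob_space.mutual_information (channel_space \<sigma> P) (exp 1)
      (\<Pi>\<^sub>M k\<in>{1..n}. (borel :: real measure)) borel fst (channel_output n h)"

definition capacity_E :: "nat \<Rightarrow> (nat \<Rightarrow> real) \<Rightarrow> (nat \<Rightarrow> real) \<Rightarrow> real \<Rightarrow> ereal" where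
  "capacity_E n h \<alpha> \<sigma> = (SUP P\<in>input_laws n \<alpha>. ereal (channel_information n h \<sigma> P))"

definition zeta_fn :: "real \<Rightarrow> real" where
  "zeta_fn x = (if x = 0 then 1 else (exp x - 1) / x)"

text \<open>
  In the inner sum, truncated subtraction makes \<open>{1..k-2}\<close> empty for \<open>k = 1\<close> and \<open>k = 2\<close>,
  as required.
\<close>

definition dual_objective ::
  "nat \<Rightarrow> (nat \<Rightarrow> real) \<Rightarrow> (nat \<Rightarrow> real) \<Rightarrow> real \<times> (nat \<Rightarrow> real) \<Rightarrow> real" where
  "dual_objective n h \<alpha> = (\<lambda>(\<nu>\<^sub>0, lam).
    (\<Sum>i=0..n-1. lam i * (1 - cumH h i) * alpha_bar n h \<alpha> i) - 1 - \<nu>\<^sub>0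
    + exp \<nu>\<^sub>0 *
      (\<Sum>k=1..n. h k
          * exp (- lam 0 * cumH h (k-1) + (\<Sum>i=1..k-2. lam i * (cumH h i - cumH h (k-1))))
          * zeta_fn ((- (\<Sum>i=0..k-1. lam i)) * h k)))"

definition dual_feasible :: "nat \<Rightarrow> real \<times> (nat \<Rightarrow> real) \<Rightarrow> bool" where
  "dual_feasible n = (\<lambda>(\<nu>\<^sub>0, lam). \<forall>i\<in>{1..n-1}. 0 \<le> lam i)"

text \<open>
  The value of the minimisation problem. For \<open>\<alpha> 1 < 1\<close> the infimum is attained. For \<open>\<alpha> 1 = 1\<close>
  it is finite but never attained: replacing \<open>(\<nu>\<^sub>0, lam 0, lam 1)\<close> by
  \<open>(\<nu>\<^sub>0 - t * h 1, lam 0 - t, lam 1 + t)\<close> with \<open>t > 0\<close> preserves feasibility and strictly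
  decreases the objective.
\<close>

definition gamma_E :: "nat \<Rightarrow> (nat \<Rightarrow> real) \<Rightarrow> (nat \<Rightarrow> real) \<Rightarrow> real" where
  "gamma_E n h \<alpha> = (INF p\<in>Collect (dual_feasible n). dual_objective n h \<alpha> p)"

end

theory Submission
  imports Defs
begin

text \<open>
  Put \<open>S = h 1 * X 1 + \<dots> + h n * X n\<close>. Since \<open>\<alpha>\<close> is decreasing, a law of \<open>S\<close> on the unit interval
  comes from admissible inputs as soon as its mean is right and
  \<open>E max 0 (S - cumH h i) \<le> \<Sum>k>i. h k * \<alpha> k\<close> for all \<open>i\<close>. The Lagrangian dual of maximising the
  differential entropy of \<open>S\<close> under these constraints is the minimisation problem defining
  \<open>gamma_E\<close>. At a minimiser \<open>(\<nu>, lam)\<close> the stationarity conditions say that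
  \<open>exp (\<nu> - (\<Sum>i. lam i * max 0 (s - cumH h i)))\<close> is an admissible density whose entropy is the
  minimal value. The entropy power inequality bounds the output entropy for this input from below.
\<close>

section \<open>Splitting a random variable into inputs with prescribed means\<close>

text \<open>The bound takes from duality one density that is admissible and whose entropy is the
  minimal value. Both facts are read off at a minimiser, so the existence of a minimiser is the
  crux. It follows from coercivity, which rests on strict slack in the inequality constraints; for
  \<open>\<alpha> 1 = 1\<close> this slack is missing at index 1, and a reduced problem with the
  same infimum and an attained minimum takes over. Everything probabilistic lives on a single
  standard Gaussian \<open>x\<close>. The density found is continuous and positive on a compact
  interval, so an increasing differentiable map \<open>T\<close> carries the Gaussian to it. The
  inputs become functions of \<open>x\<close>, and the differential entropy of \<open>S\<close>
  becomes the mean of \<open>ln (T' x)\<close> up to a constant. This form suits the entropy power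
  inequality for \<open>T x + z\<close>: a rotation of the two independent Gaussians
  \<open>x\<close> and \<open>z / \<sigma>\<close> proves it.\<close>

definition splits_into ::
  "'a measure \<Rightarrow> nat \<Rightarrow> (nat \<Rightarrow> real) \<Rightarrow> ('a \<Rightarrow> real) \<Rightarrow> (nat \<Rightarrow> 'a \<Rightarrow> real) \<Rightarrow> bool" where
  "splits_into M n h S X \<longleftrightarrow>
    (\<forall>k\<in>{1..n}. X k \<in> borel_measurable M \<and> (\<forall>x. 0 \<le> X k x \<and> X k x \<le> 1)) \<and>
    (\<forall>x. (\<Sum>k=1..n. h k * X k x) = S x)"

lemma (in prob_space) splits_into_integrable:
  assumes "splits_into M n h S X" "k \<in> {1..n}"
  shows "integrable M (X k)"
  using assms unfolding splits_into_def by (intro integrable_const_bound[where B=1]) auto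

text \<open>
  A weighted Hardy-Littlewood-Polya argument: as long as some mean differs from its target,
  averaging two suitable coordinates makes one more mean correct.
\<close>

lemma (in prob_space) splits_into_adjust_means:
  fixes h \<alpha> :: "nat \<Rightarrow> real"
  assumes h: "\<And>k. k \<in> {1..n} \<Longrightarrow> h k > 0"
    and anti: "\<And>j k. 1 \<le> j \<Longrightarrow> j \<le> k \<Longrightarrow> k \<le> n \<Longrightarrow> \<alpha> k \<le> \<alpha> j"
    and X: "splits_into M n h S X"
    and maj: "\<And>i. i \<le> n \<Longrightarrow> 0 \<le> (\<Sum>k=1..i. h k * (expectation (X k) - \<alpha> k))"
    and total: "(\<Sum>k=1..n. h k * (expectation (X k) - \<alpha> k)) = 0"
  shows "\<exists>X'. splits_into M n h S X' \<and> (\<forall>k\<in>{1..n}. expectation (X' k) = \<alpha> k)"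
  using X maj total
proof (induction "card {k \<in> {1..n}. expectation (X k) \<noteq> \<alpha> k}" arbitrary: X rule: less_induct)
  case (less X)
  define \<beta> where "\<beta> k = expectation (X k)" for k
  note X = less.prems(1)
  have maj: "0 \<le> (\<Sum>l=1..i. h l * (\<beta> l - \<alpha> l))" if "i \<le> n" for i
    using less.prems(2)[OF that] by (simp add: \<beta>_def)
  have total: "(\<Sum>l=1..n. h l * (\<beta> l - \<alpha> l)) = 0"
    using less.prems(3) by (simp add: \<beta>_def)
  show ?case
  proof (cases "\<forall>k\<in>{1..n}. \<beta> k = \<alpha> k")
    case True
    then show ?thesis using X by (auto simp: \<beta>_def)
  next
    case False
    then have exj: "\<exists>k. k \<in> {1..n} \<and> \<beta> k \<noteq> \<alpha> k" by blast
    \<comment> \<open>\<open>j\<close> is the first index with a wrong mean. All earlier terms of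
      the partial sum vanish, so nonnegativity of the sum up to \<open>j\<close> says that this mean
      is too large.\<close>
    define j where "j = (LEAST k. k \<in> {1..n} \<and> \<beta> k \<noteq> \<alpha> k)"
    have j: "j \<in> {1..n}" "\<beta> j \<noteq> \<alpha> j"
      using LeastI_ex[OF exj, folded j_def] by blast+
    have below: "\<beta> l = \<alpha> l" if "l \<in> {1..n}" "l < j" for l
      using not_less_Least[of l "\<lambda>k. k \<in> {1..n} \<and> \<beta> k \<noteq> \<alpha> k"] that unfolding j_def by auto
    have "(\<Sum>l=1..j. h l * (\<beta> l - \<alpha> l)) = h j * (\<beta> j - \<alpha> j)"
      using j below by (subst sum.mono_neutral_right[of _ "{j}"]) auto
    then have "0 \<le> h j * (\<beta> j - \<alpha> j)" using maj[of j] j by simp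
    then have bj: "\<alpha> j < \<beta> j" using h[OF j(1)] j(2) by (simp add: zero_le_mult_iff)
    have ex: "\<exists>k. k \<in> {1..n} \<and> \<beta> k < \<alpha> k"
    proof (rule ccontr)
      assume "\<not> ?thesis"
      then have "0 \<le> h l * (\<beta> l - \<alpha> l)" if "l \<in> {1..n}" for l
        using h[OF that] that by (force intro!: mult_nonneg_nonneg)
      then have "h j * (\<beta> j - \<alpha> j) \<le> (\<Sum>l=1..n. h l * (\<beta> l - \<alpha> l))"
        using j by (intro member_le_sum) auto
      moreover have "0 < h j * (\<beta> j - \<alpha> j)" using h[OF j(1)] bj by simp
      ultimately show False using total by simp
    qed
    \<comment> \<open>\<open>k\<close> is the first index whose mean is too small. No index before
      it is in deficit, which later keeps the intermediate partial sums nonnegative.\<close>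
    define k where "k = (LEAST k. k \<in> {1..n} \<and> \<beta> k < \<alpha> k)"
    have k: "k \<in> {1..n}" "\<beta> k < \<alpha> k"
      using LeastI_ex[OF ex, folded k_def] by blast+
    have belowk: "\<alpha> l \<le> \<beta> l" if "l \<in> {1..n}" "l < k" for l
      using not_less_Least[of l "\<lambda>k. k \<in> {1..n} \<and> \<beta> k < \<alpha> k"] that unfolding k_def by auto
    have jk: "j < k"
      using k below bj by (metis less_asym less_irrefl linorder_less_linear)
    have akj: "\<alpha> k \<le> \<alpha> j" using anti[of j k] j k jk by auto
    define d where "d = \<beta> j - \<beta> k"
    \<comment> \<open>The largest weighted mean that can move from \<open>j\<close> to
      \<open>k\<close> without overshooting either target; taking the minimum makes one of the two
      means exact. Monotonicity of \<open>\<alpha>\<close> enters here: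
      \<open>\<beta> k < \<alpha> k \<le> \<alpha> j < \<beta> j\<close> bounds both amounts by
      \<open>h j * d\<close> and \<open>h k * d\<close>, so \<open>a\<close> and \<open>b\<close>
      below are at most 1.\<close>
    define \<delta> where "\<delta> = min (h j * (\<beta> j - \<alpha> j)) (h k * (\<alpha> k - \<beta> k))"
    have hj: "h j > 0" and hk: "h k > 0" using h j k by auto
    have d: "d > 0" using bj k akj by (simp add: d_def)
    have \<delta>: "\<delta> > 0" using hj hk bj k by (simp add: \<delta>_def)
    \<comment> \<open>The mixing weights satisfy \<open>h j * a = h k * b\<close>, which preserves
      the weighted sum pointwise, and dividing by \<open>d\<close> makes the transferred weighted
      mean exactly \<open>\<delta>\<close>.\<close>
    define a where "a = \<delta> / (h j * d)"
    define b where "b = \<delta> / (h k * d)"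
    have "h j * (\<beta> j - \<alpha> j) \<le> h j * d"
      using hj k akj by (intro mult_left_mono) (auto simp: d_def)
    then have "\<delta> \<le> h j * d" by (simp add: \<delta>_def)
    then have a: "0 \<le> a" "a \<le> 1" using hj d \<delta> by (auto simp: a_def)
    have "h k * (\<alpha> k - \<beta> k) \<le> h k * d"
      using hk bj akj by (intro mult_left_mono) (auto simp: d_def)
    then have "\<delta> \<le> h k * d" by (simp add: \<delta>_def)
    then have b: "0 \<le> b" "b \<le> 1" using hk d \<delta> by (auto simp: b_def)
    have ab: "h j * a = h k * b" using hj hk d by (simp add: a_def b_def)
    define X' where "X' l = (if l = j then (\<lambda>x. (1 - a) * X j x + a * X k x)
      else if l = k then (\<lambda>x. b * X j x + (1 - b) * X k x) else X l)" for l
    have int: "integrable M (X l)" if "l \<in> {1..n}" for l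
      using splits_into_integrable[OF X that] .
    have Xb: "X l \<in> borel_measurable M" "0 \<le> X l x" "X l x \<le> 1" if "l \<in> {1..n}" for l x
      using X that unfolding splits_into_def by auto
    have conv: "0 \<le> (1 - t) * u + t * v \<and> (1 - t) * u + t * v \<le> 1"
      if "0 \<le> t" "t \<le> 1" "0 \<le> u" "u \<le> 1" "0 \<le> v" "v \<le> 1" for t u v :: real
      using that convex_bound_le[of u 1 v "1 - t" t] by auto
    have X'_diff: "h l * X' l x = h l * X l x + (if l = j then - (h j * a * (X j x - X k x)) else 0)
        + (if l = k then h j * a * (X j x - X k x) else 0)" for l x
    proof (cases "l = k")
      case True
      then show ?thesis unfolding ab using jk by (simp add: X'_def algebra_simps)
    next
      case False
      then show ?thesis by (simp add: X'_def algebra_simps)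
    qed
    have X': "splits_into M n h S X'"
      unfolding splits_into_def
    proof (intro conjI ballI allI)
      fix l x assume l: "l \<in> {1..n}"
      show "X' l \<in> borel_measurable M"
        using Xb(1)[OF l] Xb(1)[OF j(1)] Xb(1)[OF k(1)] by (auto simp: X'_def)
      show "0 \<le> X' l x" "X' l x \<le> 1"
        using conv[OF a Xb(2,3)[OF j(1)] Xb(2,3)[OF k(1)], of x]
          conv[OF b Xb(2,3)[OF k(1)] Xb(2,3)[OF j(1)], of x] Xb(2,3)[OF l, of x]
        by (auto simp: X'_def add.commute)
    next
      fix x
      have "(\<Sum>l=1..n. h l * X' l x) = (\<Sum>l=1..n. h l * X l x)"
        unfolding X'_diff using j k by (simp add: sum.distrib)
      then show "(\<Sum>l=1..n. h l * X' l x) = S x"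
        using X unfolding splits_into_def by simp
    qed
    define \<beta>' where "\<beta>' l = expectation (X' l)" for l
    have \<beta>': "\<beta>' l = (if l = j then \<beta> j - a * d else if l = k then \<beta> k + b * d else \<beta> l)" for l
      using int[OF j(1)] int[OF k(1)] by (auto simp: \<beta>'_def \<beta>_def X'_def d_def algebra_simps)
    have ad: "a * d = \<delta> / h j" "b * d = \<delta> / h k"
      using d by (auto simp: a_def b_def)
    have \<beta>'_diff: "h l * (\<beta>' l - \<alpha> l) = h l * (\<beta> l - \<alpha> l) + (if l = j then - \<delta> else 0) + (if l = k then \<delta> else 0)" for l
      using jk hj hk by (auto simp: \<beta>' ad algebra_simps)
    have sum': "(\<Sum>l=1..i. h l * (\<beta>' l - \<alpha> l)) = (\<Sum>l=1..i. h l * (\<beta> l - \<alpha> l))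
        + (if j \<le> i then - \<delta> else 0) + (if k \<le> i then \<delta> else 0)" for i
      unfolding \<beta>'_diff using j k by (simp add: sum.distrib)
    have "card {l \<in> {1..n}. \<beta>' l \<noteq> \<alpha> l} < card {l \<in> {1..n}. \<beta> l \<noteq> \<alpha> l}"
    proof (rule psubset_card_mono)
      have "\<delta> = h j * (\<beta> j - \<alpha> j) \<or> \<delta> = h k * (\<alpha> k - \<beta> k)"
        unfolding \<delta>_def min_def by simp
      then have "\<beta>' j = \<alpha> j \<or> \<beta>' k = \<alpha> k"
        using hj hk jk unfolding \<beta>' ad by auto
      moreover have "\<beta> j \<noteq> \<alpha> j" "\<beta> k \<noteq> \<alpha> k" using j k by simp_all
      moreover from this have "\<beta> l \<noteq> \<alpha> l" if "\<beta>' l \<noteq> \<alpha> l" for l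
        using that by (cases "l = j"; cases "l = k") (simp_all add: \<beta>')
      ultimately show "{l \<in> {1..n}. \<beta>' l \<noteq> \<alpha> l} \<subset> {l \<in> {1..n}. \<beta> l \<noteq> \<alpha> l}"
        using j(1) k(1) by blast
    qed simp
    then show ?thesis
      unfolding \<beta>'_def \<beta>_def
    proof (rule less.hyps[OF _ X'])
      fix i assume i: "i \<le> n"
      have "0 \<le> (\<Sum>l=1..i. h l * (\<beta>' l - \<alpha> l))"
      proof (cases "j \<le> i \<and> i < k")
        case False
        then have "(if j \<le> i then - \<delta> else 0) + (if k \<le> i then \<delta> else 0) = 0" using jk by auto
        then show ?thesis unfolding sum' using maj[OF i] by linarith
      next
        \<comment> \<open>Only in this range does the partial sum drop, by \<open>\<delta>\<close>.
          Its terms are nonnegative because \<open>i\<close> precedes \<open>k\<close>, and the term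
          at \<open>j\<close> alone is at least \<open>\<delta>\<close>.\<close>
        case True
        have "0 \<le> h l * (\<beta> l - \<alpha> l)" if "l \<in> {1..i}" for l
          using h[of l] belowk[of l] that True i by simp
        then have "h j * (\<beta> j - \<alpha> j) \<le> (\<Sum>l=1..i. h l * (\<beta> l - \<alpha> l))"
          using True j by (intro member_le_sum) auto
        moreover have "\<delta> \<le> h j * (\<beta> j - \<alpha> j)" by (simp add: \<delta>_def)
        ultimately show ?thesis unfolding sum' using True by simp
      qed
      then show "0 \<le> (\<Sum>l=1..i. h l * (expectation (X' l) - \<alpha> l))" by (simp add: \<beta>'_def)
    next
      have "(\<Sum>l=1..n. h l * (\<beta>' l - \<alpha> l)) = 0"
        unfolding sum' using total j k by simp
      then show "(\<Sum>l=1..n. h l * (expectation (X' l) - \<alpha> l)) = 0" by (simp add: \<beta>'_def)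
    qed
  qed
qed

lemma cumH_0 [simp]: "cumH h 0 = 0"
  by (simp add: cumH_def)

lemma cumH_Suc: "cumH h (Suc k) = cumH h k + h (Suc k)"
  by (simp add: cumH_def)

text \<open>
  Filling the coordinates in the order \<open>1, 2, \<dots>\<close> gives the decomposition of \<open>S\<close> whose means
  majorise those of all others; its partial sums are \<open>S - max 0 (S - cumH h i)\<close>.
\<close>

lemma (in prob_space) splits_into_exists:
  fixes h \<alpha> :: "nat \<Rightarrow> real" and S :: "'a \<Rightarrow> real"
  assumes h: "\<And>k. k \<in> {1..n} \<Longrightarrow> h k > 0" and h1: "cumH h n = 1"
    and anti: "\<And>j k. 1 \<le> j \<Longrightarrow> j \<le> k \<Longrightarrow> k \<le> n \<Longrightarrow> \<alpha> k \<le> \<alpha> j"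
    and S[measurable]: "S \<in> borel_measurable M" and S_bounds: "\<And>x. 0 \<le> S x" "\<And>x. S x \<le> 1"
    and mean: "expectation S = (\<Sum>k=1..n. h k * \<alpha> k)"
    and tails: "\<And>i. i \<le> n \<Longrightarrow> expectation (\<lambda>x. max 0 (S x - cumH h i)) \<le> (\<Sum>k=i+1..n. h k * \<alpha> k)"
  shows "\<exists>X. splits_into M n h S X \<and> (\<forall>k\<in>{1..n}. expectation (X k) = \<alpha> k)"
proof -
  \<comment> \<open>The fraction of the cell from \<open>cumH h (k - 1)\<close> to
    \<open>cumH h k\<close> that lies below \<open>S x\<close>.\<close>
  define X where "X k x = (max 0 (S x - cumH h (k - 1)) - max 0 (S x - cumH h k)) / h k" for k x
  have Xh: "h k * X k x = max 0 (S x - cumH h (k - 1)) - max 0 (S x - cumH h k)" if "k \<in> {1..n}" for k x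
    using h[OF that] by (simp add: X_def)
  have partial: "(\<Sum>k=1..i. h k * X k x) = S x - max 0 (S x - cumH h i)" if "i \<le> n" for i x
    using that
  proof (induction i)
    case 0
    then show ?case using S_bounds(1)[of x] by (simp add: cumH_def)
  next
    case (Suc i)
    then show ?case using Xh[of "Suc i" x] by simp
  qed
  have XS: "splits_into M n h S X"
    unfolding splits_into_def
  proof (intro conjI ballI allI)
    fix k x assume k: "k \<in> {1..n}"
    then have cH: "cumH h k = cumH h (k - 1) + h k" using cumH_Suc[of h "k - 1"] by simp
    show "X k \<in> borel_measurable M" unfolding X_def[abs_def] by measurable
    show "0 \<le> X k x" "X k x \<le> 1"
      unfolding X_def cH using h[OF k] by (auto simp: max_def)
  next
    show "(\<Sum>k=1..n. h k * X k x) = S x" for x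
      using partial[of n x] S_bounds(2)[of x] h1 by (simp add: max_def)
  qed
  have intS: "integrable M S" "integrable M (\<lambda>x. max 0 (S x - cumH h i))" for i
  proof -
    show iS: "integrable M S" using S_bounds by (intro integrable_const_bound[where B=1]) auto
    then show "integrable M (\<lambda>x. max 0 (S x - cumH h i))"
      by (intro integrable_max) auto
  qed
  \<comment> \<open>The filling telescopes, so a partial sum of the means involves a single hinge
    mean. The majorisation needed for adjusting the means thus becomes the hypothesis
    \<open>tails\<close>.\<close>
  have means: "(\<Sum>k=1..i. h k * (expectation (X k) - \<alpha> k))
      = (\<Sum>k=1..n. h k * \<alpha> k) - expectation (\<lambda>x. max 0 (S x - cumH h i)) - (\<Sum>k=1..i. h k * \<alpha> k)" if "i \<le> n" for i
  proof -
    have "(\<Sum>k=1..i. h k * expectation (X k)) = expectation (\<lambda>x. \<Sum>k=1..i. h k * X k x)"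
      using that splits_into_integrable[OF XS] by (subst Bochner_Integration.integral_sum) auto
    also have "\<dots> = expectation S - expectation (\<lambda>x. max 0 (S x - cumH h i))"
      unfolding partial[OF that] using intS by simp
    finally show ?thesis by (simp add: right_diff_distrib sum_subtractf mean)
  qed
  have split: "(\<Sum>k=1..n. h k * \<alpha> k) - (\<Sum>k=1..i. h k * \<alpha> k) = (\<Sum>k=i+1..n. h k * \<alpha> k)" if "i \<le> n" for i
    using that sum.ub_add_nat[of 1 i "\<lambda>k. h k * \<alpha> k" "n - i"] by simp
  show ?thesis
  proof (rule splits_into_adjust_means[OF h anti XS])
    show "0 \<le> (\<Sum>k=1..i. h k * (expectation (X k) - \<alpha> k))" if "i \<le> n" for i
      using means[OF that] tails[OF that] split[OF that] by simp
    have "(\<lambda>x. max 0 (S x - cumH h n)) = (\<lambda>x. 0)"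
      using S_bounds(2) h1 by (intro ext max_absorb1) simp
    then show "(\<Sum>k=1..n. h k * (expectation (X k) - \<alpha> k)) = 0"
      using means[of n] by simp
  qed auto
qed

section \<open>The maximum entropy dual\<close>

text \<open>
  The dual objective is the maximum entropy dual for the constraints \<open>E max 0 (S - cumH h i) \<le> mean_tail n h \<alpha> i\<close>, with equality
  for \<open>i = m\<close>. The parameter \<open>m\<close> is 0 if \<open>\<alpha> 1 < 1\<close>. If \<open>\<alpha> 1 = 1\<close>, the first input is constantly
  1, and \<open>m = 1\<close> removes it.
\<close>

definition log_tilt :: "nat \<Rightarrow> nat \<Rightarrow> (nat \<Rightarrow> real) \<Rightarrow> real \<Rightarrow> (nat \<Rightarrow> real) \<Rightarrow> real \<Rightarrow> real" where
  "log_tilt m n h \<nu> lam s = \<nu> - (\<Sum>i=m..<n. lam i * max 0 (s - cumH h i))"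

text \<open>For \<open>i < n\<close> this is
  \<open>(1 - cumH h i) * alpha_bar n h \<alpha> i\<close>, freed of its division.\<close>

definition mean_tail :: "nat \<Rightarrow> (nat \<Rightarrow> real) \<Rightarrow> (nat \<Rightarrow> real) \<Rightarrow> nat \<Rightarrow> real" where
  "mean_tail n h \<alpha> i = (\<Sum>k=i+1..n. h k * \<alpha> k)"

text \<open>The supremum of the Lagrangian over nonnegative densities \<open>f\<close>, with
  multiplier \<open>\<nu> + 1\<close> for normalisation. At each point,
  \<open>- f * ln f + (1 + log_tilt) * f\<close> is largest for \<open>f = exp log_tilt\<close>,
  where its value is \<open>f\<close> itself; this leaves the integral and the constants
  \<open>- 1 - \<nu>\<close>.\<close>

definition maxent_dual ::
  "nat \<Rightarrow> nat \<Rightarrow> (nat \<Rightarrow> real) \<Rightarrow> (nat \<Rightarrow> real) \<Rightarrow> real \<Rightarrow> (nat \<Rightarrow> real) \<Rightarrow> real" where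
  "maxent_dual m n h \<alpha> \<nu> lam = (\<Sum>i=m..<n. lam i * mean_tail n h \<alpha> i) - 1 - \<nu>
     + integral {cumH h m..1} (\<lambda>s. exp (log_tilt m n h \<nu> lam s))"

section \<open>The dual integral in closed form, cell by cell\<close>

lemma continuous_on_log_tilt [continuous_intros]: "continuous_on A (log_tilt m n h \<nu> lam)"
  unfolding log_tilt_def[abs_def] by (intro continuous_intros)

lemma integrable_exp_log_tilt: "(\<lambda>s. exp (log_tilt m n h \<nu> lam s)) integrable_on {u..v}"
  by (intro integrable_continuous_interval continuous_intros)

lemma cumH_mono:
  assumes "\<And>k. k \<in> {1..n} \<Longrightarrow> h k > 0" "i \<le> j" "j \<le> n"
  shows "cumH h i \<le> cumH h j"
  unfolding cumH_def using assms by (intro sum_mono2) (auto intro!: less_imp_le)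

lemma cumH_strict_mono:
  assumes h: "\<And>k. k \<in> {1..n} \<Longrightarrow> h k > 0" and "i < j" "j \<le> n"
  shows "cumH h i < cumH h j"
proof -
  have "cumH h i \<le> cumH h (j - 1)" using assms by (intro cumH_mono[OF h]) auto
  also have "\<dots> < cumH h j" using assms cumH_Suc[of h "j - 1"] h[of j] by simp
  finally show ?thesis .
qed

text \<open>\<open>zeta_fn w\<close> is the mean value of \<open>exp\<close> over the segment
  between 0 and \<open>w\<close>. This is how it enters the dual, and why its value at 0 has to be
  1.\<close>

lemma integral_exp_affine:
  fixes a u A B :: real
  assumes "u \<ge> 0"
  shows "integral {a..a + u} (\<lambda>s. exp (A + B * (s - a))) = exp A * (u * zeta_fn (B * u))"
proof (cases "B = 0 \<or> u = 0")
  case True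
  then show ?thesis using assms by (auto simp: zeta_fn_def)
next
  case False
  have "((\<lambda>s. exp (A + B * (s - a))) has_integral exp (A + B * (a + u - a)) / B - exp (A + B * (a - a)) / B) {a..a + u}"
    using assms False
    by (intro fundamental_theorem_of_calculus)
       (auto intro!: derivative_eq_intros simp: has_real_derivative_iff_has_vector_derivative[symmetric])
  then have "integral {a..a + u} (\<lambda>s. exp (A + B * (s - a))) = exp (A + B * u) / B - exp A / B"
    by (simp add: integral_unique)
  moreover have "exp A * (u * zeta_fn (B * u)) = exp (A + B * u) / B - exp A / B"
    using False by (simp add: zeta_fn_def exp_add field_simps)
  ultimately show ?thesis by simp
qed

text \<open>Between \<open>cumH h (k - 1)\<close> and \<open>cumH h k\<close> exactly the hinges
  with index at most \<open>k - 1\<close> are active, so the exponent is affine there with slope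
  minus the sum of their multipliers. The induction adds one cell at a time.\<close>

lemma integral_exp_log_tilt:
  assumes h: "\<And>k. k \<in> {1..n} \<Longrightarrow> h k > 0" and "j \<le> n"
  shows "integral {0..cumH h j} (\<lambda>s. exp (log_tilt 0 n h \<nu> lam s)) =
    exp \<nu> * (\<Sum>k=1..j. h k
      * exp (- lam 0 * cumH h (k-1) + (\<Sum>i=1..k-2. lam i * (cumH h i - cumH h (k-1))))
      * zeta_fn ((- (\<Sum>i=0..k-1. lam i)) * h k))"
  using \<open>j \<le> n\<close>
proof (induction j)
  case 0
  then show ?case by simp
next
  case (Suc j)
  let ?H = "cumH h j"
  define B where "B = (\<Sum>i=0..j. lam i)"
  define A where "A = - lam 0 * ?H + (\<Sum>i=1..j - 1. lam i * (cumH h i - ?H))"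
  have hS: "h (Suc j) > 0" using h Suc.prems by auto
  have H0: "0 \<le> ?H" using cumH_mono[where h=h and i=0 and j=j and n=n] h Suc.prems by simp
  \<comment> \<open>\<open>\<nu> + A\<close> is the exponent at the left end of the new cell. The
    hinge with index \<open>j\<close> vanishes there, so the sum may stop at \<open>j - 1\<close>,
    which is \<open>k - 2\<close> for \<open>k = Suc j\<close>.\<close>
  have A: "A = - (\<Sum>i=0..j. lam i * (?H - cumH h i))"
  proof (cases j)
    case 0
    then show ?thesis by (simp add: A_def)
  next
    case (Suc j')
    have "(\<Sum>i=0..j. lam i * (?H - cumH h i)) = lam 0 * ?H + (\<Sum>i=1..j'. lam i * (?H - cumH h i))"
      unfolding Suc by (simp add: sum.atLeast_Suc_atMost)
    then show ?thesis unfolding A_def Suc by (simp add: sum_negf[symmetric] algebra_simps)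
  qed
  have "integral {?H..?H + h (Suc j)} (\<lambda>s. exp (log_tilt 0 n h \<nu> lam s))
      = integral {?H..?H + h (Suc j)} (\<lambda>s. exp ((\<nu> + A) + (- B) * (s - ?H)))"
  proof (intro integral_cong)
    fix s assume s: "s \<in> {?H..?H + h (Suc j)}"
    have "(\<Sum>i=0..<n. lam i * max 0 (s - cumH h i)) = (\<Sum>i=0..j. lam i * (s - cumH h i))"
    proof (rule sum.mono_neutral_cong_right)
      show "\<forall>i\<in>{0..<n} - {0..j}. lam i * max 0 (s - cumH h i) = 0"
      proof
        fix i assume i: "i \<in> {0..<n} - {0..j}"
        then have "cumH h (Suc j) \<le> cumH h i" using Suc.prems by (intro cumH_mono[OF h]) auto
        then show "lam i * max 0 (s - cumH h i) = 0" using s by (simp add: cumH_Suc max_def)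
      qed
      fix i assume i: "i \<in> {0..j}"
      then have "cumH h i \<le> ?H" using Suc.prems by (intro cumH_mono[OF h]) auto
      then show "lam i * max 0 (s - cumH h i) = lam i * (s - cumH h i)" using s by (simp add: max_def)
    qed (use Suc.prems in auto)
    also have "\<dots> = (\<Sum>i=0..j. lam i * (?H - cumH h i) + lam i * (s - ?H))"
      by (intro sum.cong) (auto simp: algebra_simps)
    also have "\<dots> = - A + B * (s - ?H)"
      by (simp add: A B_def sum.distrib sum_distrib_right)
    finally show "exp (log_tilt 0 n h \<nu> lam s) = exp ((\<nu> + A) + (- B) * (s - ?H))"
      by (simp add: log_tilt_def)
  qed
  also have "\<dots> = exp (\<nu> + A) * (h (Suc j) * zeta_fn (- B * h (Suc j)))"
    using hS by (intro integral_exp_affine) simp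
  finally have cell: "integral {?H..cumH h (Suc j)} (\<lambda>s. exp (log_tilt 0 n h \<nu> lam s))
      = exp \<nu> * (h (Suc j) * exp A * zeta_fn (- B * h (Suc j)))"
    by (simp add: cumH_Suc exp_add)
  have "integral {0..cumH h (Suc j)} (\<lambda>s. exp (log_tilt 0 n h \<nu> lam s))
     = integral {0..?H} (\<lambda>s. exp (log_tilt 0 n h \<nu> lam s))
      + integral {?H..cumH h (Suc j)} (\<lambda>s. exp (log_tilt 0 n h \<nu> lam s))"
    using H0 hS by (intro Henstock_Kurzweil_Integration.integral_combine[symmetric] integrable_exp_log_tilt) (auto simp: cumH_Suc)
  then show ?case
    unfolding cell using Suc by (simp add: A_def B_def distrib_left)
qed

lemma dual_objective_eq_maxent_dual:
  assumes h: "\<And>k. k \<in> {1..n} \<Longrightarrow> h k > 0" and h1: "cumH h n = 1" and n: "n \<ge> 1"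
  shows "dual_objective n h \<alpha> (\<nu>, lam) = maxent_dual 0 n h \<alpha> \<nu> lam"
proof -
  have "(\<Sum>i=0..n-1. lam i * (1 - cumH h i) * alpha_bar n h \<alpha> i) = (\<Sum>i=0..<n. lam i * mean_tail n h \<alpha> i)"
  proof (rule sum.cong)
    fix i assume "i \<in> {0..<n}"
    then have "cumH h i < 1" using cumH_strict_mono[where h=h and i=i and j=n and n=n] h h1 by simp
    then show "lam i * (1 - cumH h i) * alpha_bar n h \<alpha> i = lam i * mean_tail n h \<alpha> i"
      by (simp add: alpha_bar_def mean_tail_def)
  qed (use n in auto)
  then show ?thesis
    unfolding dual_objective_def maxent_dual_def prod.case
    using integral_exp_log_tilt[where h=h and n=n and j=n and \<nu>=\<nu> and lam=lam] h h1 by simp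
qed

section \<open>Coercivity of the dual and existence of a minimiser\<close>

lemma exp_average_le:
  fixes f :: "real \<Rightarrow> real"
  assumes \<epsilon>: "\<epsilon> > 0" and contf: "continuous_on {u..u + \<epsilon>} f"
  shows "\<epsilon> * exp (integral {u..u + \<epsilon>} f / \<epsilon>) \<le> integral {u..u + \<epsilon>} (\<lambda>s. exp (f s))"
proof -
  define v where "v = integral {u..u + \<epsilon>} f / \<epsilon>"
  have int: "f integrable_on {u..u + \<epsilon>}" using contf by (rule integrable_continuous_interval)
  have "((\<lambda>s. exp v * (1 - v) + exp v * f s) has_integral
      (\<epsilon> * (exp v * (1 - v)) + exp v * integral {u..u + \<epsilon>} f)) {u..u + \<epsilon>}"
    using has_integral_add[OF has_integral_const_real[of "exp v * (1 - v)" u "u + \<epsilon>"]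
      has_integral_mult_right[OF integrable_integral[OF int], of "exp v"]] \<epsilon> by simp
  then have "((\<lambda>s. exp v * (1 - v) + exp v * f s) has_integral \<epsilon> * exp v) {u..u + \<epsilon>}"
    using \<epsilon> by (simp add: v_def algebra_simps)
  \<comment> \<open>Jensen's inequality by way of the tangent line of \<open>exp\<close> at the mean
    \<open>v\<close>.\<close>
  moreover have "exp v * (1 - v) + exp v * f s \<le> exp (f s)" for s
  proof -
    have "exp v * (1 + (f s - v)) \<le> exp v * exp (f s - v)"
      by (intro mult_left_mono exp_ge_add_one_self) simp
    then show ?thesis by (simp add: exp_add[symmetric] algebra_simps)
  qed
  moreover have "((\<lambda>s. exp (f s)) has_integral integral {u..u + \<epsilon>} (\<lambda>s. exp (f s))) {u..u + \<epsilon>}"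
    by (intro integrable_integral integrable_continuous_interval continuous_intros contf)
  ultimately show ?thesis unfolding v_def[symmetric] by (blast intro: has_integral_le)
qed

text \<open>For positive \<open>u\<close> the exponential wins, for negative \<open>u\<close> the
  linear term does. The factor 1/2 fits the later split of the linear part of the dual between two
  such expressions.\<close>

lemma exp_minus_half_ge:
  fixes u \<epsilon> :: real
  assumes "\<epsilon> > 0"
  shows "\<bar>u\<bar> / 2 - \<bar>ln \<epsilon>\<bar> \<le> \<epsilon> * exp u - u / 2"
proof (cases "u \<ge> 0")
  case True
  have "\<epsilon> * exp u = exp (u + ln \<epsilon>)" using assms by (simp add: exp_add)
  then have "\<epsilon> * exp u \<ge> 1 + (u + ln \<epsilon>)" using exp_ge_add_one_self[of "u + ln \<epsilon>"] by linarith
  then show ?thesis using True by linarith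
next
  case False
  have "\<epsilon> * exp u > 0" using assms by simp
  then show ?thesis using False by linarith
qed

context
  fixes m n :: nat and h \<alpha> :: "nat \<Rightarrow> real"
  assumes mn: "m < n" and h: "\<And>k. k \<in> {1..n} \<Longrightarrow> h k > 0" and h1: "cumH h n = 1"
    and \<alpha>_pos: "\<And>k. k \<in> {1..n} \<Longrightarrow> \<alpha> k > 0"
    and \<alpha>_lt: "\<And>k. k \<in> {m+1..n} \<Longrightarrow> \<alpha> k < 1"
begin

lemma mean_tail_pos: "i < n \<Longrightarrow> mean_tail n h \<alpha> i > 0"
  unfolding mean_tail_def using h \<alpha>_pos by (intro sum_pos) auto

text \<open>Slater's condition: the point mass at
  \<open>\<mu> = cumH h m + mean_tail n h \<alpha> m\<close> meets the equality constraint and, by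
  this inequality, all the others strictly. The case \<open>i = n\<close> says
  \<open>\<mu> < 1\<close>.\<close>

lemma mean_tail_diff_less:
  assumes "m < i" "i \<le> n"
  shows "mean_tail n h \<alpha> m - mean_tail n h \<alpha> i < cumH h i - cumH h m"
proof -
  have split: "sum f {m+1..n} = sum f {m+1..i} + sum f {i+1..n}" for f :: "nat \<Rightarrow> real"
    using assms sum.ub_add_nat[of "m+1" i f "n - i"] by simp
  have H: "cumH h i = cumH h m + (\<Sum>k=m+1..i. h k)"
    unfolding cumH_def using assms sum.ub_add_nat[of 1 m h "i - m"] by simp
  have "(\<Sum>k=m+1..i. h k * \<alpha> k) < (\<Sum>k=m+1..i. h k)"
    using assms h \<alpha>_lt by (intro sum_strict_mono) auto
  then show ?thesis unfolding mean_tail_def split H by simp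
qed

text \<open>The Slater point is smeared out over the two intervals of length
  \<open>\<epsilon>\<close> to the left and right of \<open>\<mu>\<close>; \<open>p i\<close> and
  \<open>q i\<close> are the means of the hinges over them. Jensen's inequality on each interval
  bounds the integral below by two exponentials, and the slack pays for the sign-constrained
  multipliers. Two intervals are used because \<open>lam m\<close> has no sign: the difference of
  the two averaged exponents detects it through \<open>q m - p m = \<epsilon>\<close>.\<close>

lemma maxent_dual_coercive:
  obtains \<epsilon> C :: real and p q :: "nat \<Rightarrow> real" where "\<epsilon> > 0"
    "\<And>i. i \<in> {m..<n} \<Longrightarrow> 0 \<le> p i \<and> p i \<le> q i \<and> q i \<le> 1" "q m - p m = \<epsilon>"
    "\<And>\<nu> lam. \<forall>i\<in>{m+1..<n}. 0 \<le> lam i \<Longrightarrow>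
      \<epsilon> * (\<Sum>i=m+1..<n. lam i) + \<bar>\<nu> - (\<Sum>i=m..<n. lam i * p i)\<bar> / 2
        + \<bar>\<nu> - (\<Sum>i=m..<n. lam i * q i)\<bar> / 2 - C \<le> maxent_dual m n h \<alpha> \<nu> lam"
proof -
  let ?c = "mean_tail n h \<alpha>"
  define \<mu> where "\<mu> = cumH h m + ?c m"
  \<comment> \<open>The first two entries keep both intervals inside the integration range. The
    remaining ones are halved slacks: one \<open>\<epsilon>\<close> absorbs the excess of the
    smeared hinge means over the Slater point, the other is left as a coefficient of
    \<open>lam i\<close>.\<close>
  define E where "E = {?c m, 1 - \<mu>} \<union> (\<lambda>i. (?c i - max 0 (\<mu> - cumH h i)) / 2) ` {m+1..<n}"
  define \<epsilon> where "\<epsilon> = Min E"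
  have E: "finite E" "E \<noteq> {}" by (auto simp: E_def)
  have "?c n = 0" by (simp add: mean_tail_def)
  then have \<mu>1: "\<mu> < 1" using mean_tail_diff_less[of n] mn h1 by (simp add: \<mu>_def)
  have pos: "x > 0" if "x \<in> E" for x
  proof -
    have "max 0 (\<mu> - cumH h i) < ?c i" if "i \<in> {m+1..<n}" for i
      using mean_tail_pos[of i] mean_tail_diff_less[of i] that by (simp add: \<mu>_def)
    then show ?thesis using that mean_tail_pos[of m] mn \<mu>1 unfolding E_def by auto
  qed
  have \<epsilon>: "\<epsilon> > 0" using E pos by (simp add: \<epsilon>_def)
  have \<epsilon>le: "\<epsilon> \<le> x" if "x \<in> E" for x using E that by (simp add: \<epsilon>_def)
  have \<epsilon>1: "cumH h m \<le> \<mu> - \<epsilon>" "\<mu> + \<epsilon> \<le> 1"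
    using \<epsilon>le[of "?c m"] \<epsilon>le[of "1 - \<mu>"] by (auto simp: E_def \<mu>_def)
  have \<epsilon>2: "max 0 (\<mu> - cumH h i) + 2 * \<epsilon> \<le> ?c i" if "i \<in> {m+1..<n}" for i
    using \<epsilon>le[of "(?c i - max 0 (\<mu> - cumH h i)) / 2"] that by (auto simp: E_def)
  have H0: "0 \<le> cumH h i" if "i \<le> n" for i
    using cumH_mono[where h=h and i=0 and j=i and n=n] h that by simp
  define avg where "avg u f = integral {u..u + \<epsilon>} f / \<epsilon>" for u and f :: "real \<Rightarrow> real"
  define p where "p i = avg (\<mu> - \<epsilon>) (\<lambda>s. max 0 (s - cumH h i))" for i
  define q where "q i = avg \<mu> (\<lambda>s. max 0 (s - cumH h i))" for i
  have contmax: "continuous_on A (\<lambda>s. max 0 (s - x))" for A and x :: real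
    by (intro continuous_intros)
  have intmax: "(\<lambda>s. max 0 (s - x)) integrable_on {u..v}" for u v x :: real
    by (intro integrable_continuous_interval contmax)
  have avg_mono: "avg u f \<le> c" if "continuous_on {u..u + \<epsilon>} f" "\<And>s. s \<in> {u..u + \<epsilon>} \<Longrightarrow> f s \<le> c" for u f c
  proof -
    have "integral {u..u + \<epsilon>} f \<le> integral {u..u + \<epsilon>} (\<lambda>_. c)"
      using that by (intro integral_le integrable_continuous_interval) auto
    then show ?thesis using \<epsilon> by (simp add: avg_def field_simps)
  qed
  have avg_ge: "c \<le> avg u f" if "continuous_on {u..u + \<epsilon>} f" "\<And>s. s \<in> {u..u + \<epsilon>} \<Longrightarrow> c \<le> f s" for u f c
  proof -
    have "integral {u..u + \<epsilon>} (\<lambda>_. c) \<le> integral {u..u + \<epsilon>} f"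
      using that by (intro integral_le integrable_continuous_interval) auto
    then show ?thesis using \<epsilon> by (simp add: avg_def field_simps)
  qed
  have p0: "0 \<le> p i" for i unfolding p_def by (rule avg_ge[OF contmax]) simp
  have pm: "p i \<le> max 0 (\<mu> - cumH h i)" for i unfolding p_def by (rule avg_mono[OF contmax]) auto
  have qm: "max 0 (\<mu> - cumH h i) \<le> q i" for i unfolding q_def by (rule avg_ge[OF contmax]) auto
  have q\<epsilon>: "q i \<le> max 0 (\<mu> - cumH h i) + \<epsilon>" for i
    unfolding q_def by (rule avg_mono[OF contmax]) (use \<epsilon> in auto)
  have q1: "q i \<le> 1" if "i \<le> n" for i
    unfolding q_def by (rule avg_mono[OF contmax]) (use H0[OF that] \<epsilon>1 in auto)
  have lin: "integral {u..u + \<epsilon>} (\<lambda>s. max 0 (s - cumH h m)) = \<epsilon> * (u - cumH h m) + \<epsilon>\<^sup>2 / 2"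
    if "u \<ge> cumH h m" for u
  proof -
    have "((\<lambda>s. s - cumH h m) has_integral
        ((u + \<epsilon> - cumH h m)\<^sup>2 / 2 - (u - cumH h m)\<^sup>2 / 2)) {u..u + \<epsilon>}"
      using \<epsilon> by (intro fundamental_theorem_of_calculus)
       (auto intro!: derivative_eq_intros simp: has_real_derivative_iff_has_vector_derivative[symmetric])
    then have "((\<lambda>s. max 0 (s - cumH h m)) has_integral
        ((u + \<epsilon> - cumH h m)\<^sup>2 / 2 - (u - cumH h m)\<^sup>2 / 2)) {u..u + \<epsilon>}"
      by (rule has_integral_eq[rotated]) (use that in \<open>auto simp: max_def\<close>)
    then show ?thesis
      by (subst integral_unique) (auto simp: power2_eq_square field_simps)
  qed
  \<comment> \<open>The hinge with index \<open>m\<close> is linear on both intervals, so its means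
    are its values at the midpoints \<open>\<mu> - \<epsilon> / 2\<close> and
    \<open>\<mu> + \<epsilon> / 2\<close>.\<close>
  have pmm: "p m = ?c m - \<epsilon> / 2"
    using \<epsilon> \<epsilon>1 unfolding p_def avg_def by (subst lin) (auto simp: \<mu>_def power2_eq_square field_simps)
  have qmm: "q m = ?c m + \<epsilon> / 2"
    using \<epsilon> \<epsilon>1 unfolding q_def avg_def by (subst lin) (auto simp: \<mu>_def power2_eq_square field_simps)
  have coercive: "\<epsilon> * (\<Sum>i=m+1..<n. lam i) + \<bar>\<nu> - (\<Sum>i=m..<n. lam i * p i)\<bar> / 2
        + \<bar>\<nu> - (\<Sum>i=m..<n. lam i * q i)\<bar> / 2 - (1 + 2 * \<bar>ln \<epsilon>\<bar>) \<le> maxent_dual m n h \<alpha> \<nu> lam"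
    if lam: "\<forall>i\<in>{m+1..<n}. 0 \<le> lam i" for \<nu> lam
  proof -
    let ?t = "log_tilt m n h \<nu> lam"
    define u where "u = \<nu> - (\<Sum>i=m..<n. lam i * p i)"
    define v where "v = \<nu> - (\<Sum>i=m..<n. lam i * q i)"
    have avg_t: "avg w ?t = \<nu> - (\<Sum>i=m..<n. lam i * avg w (\<lambda>s. max 0 (s - cumH h i)))" for w
    proof -
      have "integral {w..w + \<epsilon>} ?t = integral {w..w + \<epsilon>} (\<lambda>s. \<nu>)
          - integral {w..w + \<epsilon>} (\<lambda>s. \<Sum>i=m..<n. lam i * max 0 (s - cumH h i))"
        unfolding log_tilt_def
        by (intro integral_diff integrable_sum integrable_continuous_interval continuous_intros) auto
      also have "\<dots> = \<epsilon> * \<nu> - (\<Sum>i=m..<n. lam i * integral {w..w + \<epsilon>} (\<lambda>s. max 0 (s - cumH h i)))"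
        using \<epsilon> intmax by (subst integral_sum) (auto intro!: integrable_continuous_interval continuous_intros)
      finally show ?thesis
        using \<epsilon> by (simp add: avg_def diff_divide_distrib sum_divide_distrib)
    qed
    have J: "\<epsilon> * exp u \<le> integral {\<mu> - \<epsilon>..\<mu>} (\<lambda>s. exp (?t s))"
      "\<epsilon> * exp v \<le> integral {\<mu>..\<mu> + \<epsilon>} (\<lambda>s. exp (?t s))"
      using exp_average_le[OF \<epsilon> continuous_on_log_tilt, of "\<mu> - \<epsilon>" m n h \<nu> lam]
        exp_average_le[OF \<epsilon> continuous_on_log_tilt, of \<mu> m n h \<nu> lam]
        avg_t[of "\<mu> - \<epsilon>"] avg_t[of \<mu>]
      by (simp_all add: u_def v_def p_def q_def avg_def)
    have "integral {\<mu> - \<epsilon>..\<mu>} (\<lambda>s. exp (?t s)) + integral {\<mu>..\<mu> + \<epsilon>} (\<lambda>s. exp (?t s))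
        = integral {\<mu> - \<epsilon>..\<mu> + \<epsilon>} (\<lambda>s. exp (?t s))"
      using \<epsilon> by (intro Henstock_Kurzweil_Integration.integral_combine integrable_exp_log_tilt) auto
    also have "\<dots> \<le> integral {cumH h m..1} (\<lambda>s. exp (?t s))"
      using \<epsilon>1 by (intro integral_subset_le integrable_exp_log_tilt) auto
    finally have I: "\<epsilon> * exp u + \<epsilon> * exp v \<le> integral {cumH h m..1} (\<lambda>s. exp (?t s))"
      using J by simp
    \<comment> \<open>At index \<open>m\<close> the average of \<open>p\<close> and \<open>q\<close>
      must hit the target exactly, because an error there would be multiplied by a number of either
      sign.\<close>
    have "(\<Sum>i=m..<n. lam i * ((p i + q i) / 2)) + \<epsilon> * (\<Sum>i=m+1..<n. lam i) \<le> (\<Sum>i=m..<n. lam i * ?c i)"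
    proof -
      have "lam i * ((p i + q i) / 2) + \<epsilon> * lam i \<le> lam i * ?c i" if "i \<in> {m+1..<n}" for i
      proof -
        have "(p i + q i) / 2 + \<epsilon> \<le> ?c i" 
        proof -
          have "(P + Q) / 2 + \<epsilon> \<le> c" if "P \<le> x" "Q \<le> x + \<epsilon>" "x + 2 * \<epsilon> \<le> c" for P Q x c :: real
            using that \<epsilon> by (simp add: field_simps)
          then show ?thesis using pm[of i] q\<epsilon>[of i] \<epsilon>2[OF that] .
        qed
        then have "lam i * ((p i + q i) / 2 + \<epsilon>) \<le> lam i * ?c i"
          using lam that by (intro mult_left_mono) auto
        then show ?thesis by (simp add: algebra_simps)
      qed
      then have "(\<Sum>i=m+1..<n. lam i * ((p i + q i) / 2) + \<epsilon> * lam i) \<le> (\<Sum>i=m+1..<n. lam i * ?c i)"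
        by (rule sum_mono)
      moreover have "(p m + q m) / 2 = ?c m" by (simp add: pmm qmm)
      ultimately show ?thesis
        using mn by (simp add: sum.atLeast_Suc_lessThan sum.distrib sum_distrib_left)
    qed
    moreover have "(\<Sum>i=m..<n. lam i * ((p i + q i) / 2)) - \<nu> = - (u + v) / 2"
      by (simp add: u_def v_def add_divide_distrib sum.distrib distrib_left sum_divide_distrib diff_divide_distrib)
    ultimately show ?thesis
      using I exp_minus_half_ge[OF \<epsilon>, of u] exp_minus_half_ge[OF \<epsilon>, of v]
      unfolding maxent_dual_def u_def[symmetric] v_def[symmetric] by (simp add: add_divide_distrib)
  qed
  show ?thesis
  proof (rule that[OF \<epsilon> _ _ coercive])
    show "0 \<le> p i \<and> p i \<le> q i \<and> q i \<le> 1" if "i \<in> {m..<n}" for i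
      using p0[of i] pm[of i] qm[of i] q1[of i] that by auto
    show "q m - p m = \<epsilon>" by (simp add: pmm qmm)
  qed
qed

text \<open>Each term of the coercive bound controls one kind of variable: the first the multipliers
  beyond \<open>m\<close>, the difference of the other two \<open>lam m\<close>, and then one of
  them \<open>\<nu>\<close>.\<close>

lemma maxent_dual_sublevel_bounded:
  obtains B where "\<And>\<nu> lam i. \<forall>i\<in>{m+1..<n}. 0 \<le> lam i \<Longrightarrow> maxent_dual m n h \<alpha> \<nu> lam \<le> K
    \<Longrightarrow> \<bar>\<nu>\<bar> \<le> B \<and> (\<forall>i\<in>{m..<n}. \<bar>lam i\<bar> \<le> B)"
proof (rule maxent_dual_coercive)
  fix \<epsilon> C :: real and p q :: "nat \<Rightarrow> real" assume \<epsilon>: "\<epsilon> > 0"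
    and pq: "\<And>i. i \<in> {m..<n} \<Longrightarrow> 0 \<le> p i \<and> p i \<le> q i \<and> q i \<le> 1" and pqm: "q m - p m = \<epsilon>"
    and co: "\<And>\<nu> lam. \<forall>i\<in>{m+1..<n}. 0 \<le> lam i \<Longrightarrow>
      \<epsilon> * (\<Sum>i=m+1..<n. lam i) + \<bar>\<nu> - (\<Sum>i=m..<n. lam i * p i)\<bar> / 2
        + \<bar>\<nu> - (\<Sum>i=m..<n. lam i * q i)\<bar> / 2 - C \<le> maxent_dual m n h \<alpha> \<nu> lam"
  define A where "A = \<bar>K\<bar> + \<bar>C\<bar>"
  \<comment> \<open>\<open>B1\<close> bounds the sum of the multipliers beyond \<open>m\<close>. In
    \<open>B2\<close>, \<open>4 * A\<close> bounds the difference of the two averaged exponents,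
    \<open>B1\<close> the contribution of those multipliers to it, and \<open>\<epsilon>\<close> is
    the coefficient of \<open>lam m\<close>.\<close>
  define B1 where "B1 = A / \<epsilon>"
  define B2 where "B2 = (4 * A + B1) / \<epsilon>"
  have A0: "A \<ge> 0" by (simp add: A_def)
  then have B0: "B1 \<ge> 0" "B2 \<ge> 0" using \<epsilon> by (auto simp: B1_def B2_def)
  show ?thesis
  proof (rule that[of "2 * A + B1 + B2"])
    fix \<nu> lam assume lam: "\<forall>i\<in>{m+1..<n}. 0 \<le> lam i" and K: "maxent_dual m n h \<alpha> \<nu> lam \<le> K"
    define L where "L = (\<Sum>i=m+1..<n. lam i)"
    define u where "u = \<nu> - (\<Sum>i=m..<n. lam i * p i)"
    define v where "v = \<nu> - (\<Sum>i=m..<n. lam i * q i)"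
    have L0: "L \<ge> 0" unfolding L_def using lam by (intro sum_nonneg) auto
    have "\<epsilon> * L + \<bar>u\<bar> / 2 + \<bar>v\<bar> / 2 \<le> A"
      using co[OF lam, of \<nu>] K unfolding A_def L_def u_def v_def by linarith
    moreover have "\<epsilon> * L \<ge> 0" using \<epsilon> L0 by simp
    ultimately have "\<epsilon> * L \<le> A" and u: "\<bar>u\<bar> \<le> 2 * A" and v: "\<bar>v\<bar> \<le> 2 * A" by linarith+
    then have L: "L \<le> B1" using \<epsilon> by (simp add: B1_def field_simps)
    have bound: "0 \<le> (\<Sum>i=m+1..<n. lam i * w i) \<and> (\<Sum>i=m+1..<n. lam i * w i) \<le> L"
      if "\<And>i. i \<in> {m+1..<n} \<Longrightarrow> 0 \<le> w i \<and> w i \<le> 1" for w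
    proof
      show "0 \<le> (\<Sum>i=m+1..<n. lam i * w i)" using lam that by (intro sum_nonneg) auto
      show "(\<Sum>i=m+1..<n. lam i * w i) \<le> L"
        unfolding L_def using lam that by (intro sum_mono) (auto intro!: mult_left_le)
    qed
    have pq': "0 \<le> q i - p i \<and> q i - p i \<le> 1" if "i \<in> {m+1..<n}" for i
      using pq[of i] that by auto
    have "u - v = (\<Sum>i=m..<n. lam i * (q i - p i))"
      by (simp add: u_def v_def right_diff_distrib sum_subtractf)
    also have "\<dots> = lam m * \<epsilon> + (\<Sum>i=m+1..<n. lam i * (q i - p i))"
      using mn pqm by (simp add: sum.atLeast_Suc_lessThan)
    finally have uv: "u - v = lam m * \<epsilon> + (\<Sum>i=m+1..<n. lam i * (q i - p i))" .
    have "\<bar>lam m * \<epsilon>\<bar> \<le> 4 * A + B1"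
      using uv u v bound[of "\<lambda>i. q i - p i", OF pq'] L by linarith
    then have lm: "\<bar>lam m\<bar> \<le> B2" using \<epsilon> by (simp add: B2_def field_simps abs_mult)
    have "\<nu> = v + lam m * q m + (\<Sum>i=m+1..<n. lam i * q i)"
      using mn by (simp add: v_def sum.atLeast_Suc_lessThan)
    moreover have "\<bar>lam m * q m\<bar> \<le> B2"
    proof -
      have "\<bar>lam m\<bar> * \<bar>q m\<bar> \<le> B2 * 1"
        using lm pq[of m] mn B0 by (intro mult_mono) auto
      then show ?thesis by (simp add: abs_mult)
    qed
    moreover have "0 \<le> (\<Sum>i=m+1..<n. lam i * q i) \<and> (\<Sum>i=m+1..<n. lam i * q i) \<le> L"
    proof (rule bound)
      fix i assume "i \<in> {m+1..<n}"
      then have "0 \<le> p i \<and> p i \<le> q i \<and> q i \<le> 1" by (intro pq) auto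
      then show "0 \<le> q i \<and> q i \<le> 1" by linarith
    qed
    ultimately have \<nu>: "\<bar>\<nu>\<bar> \<le> 2 * A + B1 + B2" using v L by linarith
    have "\<bar>lam i\<bar> \<le> 2 * A + B1 + B2" if "i \<in> {m..<n}" for i
    proof (cases "i = m")
      case True
      then show ?thesis using lm A0 B0 by simp
    next
      case False
      then have i: "i \<in> {m+1..<n}" using that by auto
      have "lam i \<le> L" unfolding L_def using i lam by (intro member_le_sum) auto
      moreover have "0 \<le> lam i" using i lam by auto
      ultimately show ?thesis using L A0 B0 by linarith
    qed
    with \<nu> show "\<bar>\<nu>\<bar> \<le> 2 * A + B1 + B2 \<and> (\<forall>i\<in>{m..<n}. \<bar>lam i\<bar> \<le> 2 * A + B1 + B2)" by blast
  qed
qed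

text \<open>The multiplier functions carry the product topology; the dual depends on finitely many
  of their coordinates, and each coordinate is continuous.\<close>

lemma continuous_on_maxent_dual:
  "continuous_on U (\<lambda>p. maxent_dual m n h \<alpha> (fst p) (snd p))"
proof -
  have coord: "continuous_on V (\<lambda>x. f x i)" if "continuous_on V f"
    for V :: "'b::topological_space set" and f :: "'b \<Rightarrow> nat \<Rightarrow> real" and i
    by (rule continuous_on_compose2[OF continuous_on_product_coordinates that]) auto
  have c1: "continuous_on U (\<lambda>p. snd p i)" for i
    by (rule coord) (intro continuous_intros)
  have c2: "continuous_on (U \<times> cbox (cumH h m) 1) (\<lambda>p. snd (fst p) i)" for i
    by (rule coord) (intro continuous_intros)
  have "continuous_on (U \<times> cbox (cumH h m) 1) (\<lambda>(p, s). exp (log_tilt m n h (fst p) (snd p) s))"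
    unfolding log_tilt_def case_prod_beta
    by (intro continuous_intros c2)
  then have "continuous_on U (\<lambda>p. integral {cumH h m..1} (\<lambda>s. exp (log_tilt m n h (fst p) (snd p) s)))"
    using integral_continuous_on_param[of U "cumH h m" 1 "\<lambda>p s. exp (log_tilt m n h (fst p) (snd p) s)"]
    by simp
  then show ?thesis
    unfolding maxent_dual_def
    by (intro continuous_intros c1)
qed

lemma maxent_dual_attained:
  obtains \<nu> lam where "\<forall>i\<in>{m+1..<n}. 0 \<le> lam i"
    and "\<And>\<nu>' lam'. \<forall>i\<in>{m+1..<n}. 0 \<le> lam' i \<Longrightarrow> maxent_dual m n h \<alpha> \<nu> lam \<le> maxent_dual m n h \<alpha> \<nu>' lam'"
proof -
  let ?D = "maxent_dual m n h \<alpha>"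
  define K where "K = ?D 0 (\<lambda>_. 0)"
  obtain B where B: "\<And>\<nu> lam i. \<forall>i\<in>{m+1..<n}. 0 \<le> lam i \<Longrightarrow> ?D \<nu> lam \<le> K
    \<Longrightarrow> \<bar>\<nu>\<bar> \<le> B \<and> (\<forall>i\<in>{m..<n}. \<bar>lam i\<bar> \<le> B)"
    using maxent_dual_sublevel_bounded by blast
  have zero: "\<bar>0\<bar> \<le> B" using B[of "\<lambda>_. 0" 0] by (simp add: K_def)
  \<comment> \<open>Coordinates that do not enter the dual are pinned to 0, so that the product over
    all natural numbers is compact by Tychonoff. A competitor is moved into this box by resetting
    those coordinates, which leaves its value unchanged.\<close>
  define R where "R = {-B..B} \<times> PiE UNIV (\<lambda>i. if i \<in> {m+1..<n} then {0..B} else if i = m then {-B..B} else {0})"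
  have "compact (PiE UNIV (\<lambda>i. if i \<in> {m+1..<n} then {0..B} else if i = m then {-B..B} else {0}))"
    unfolding compactin_euclidean_iff[symmetric] euclidean_product_topology[symmetric]
    by (subst compactin_PiE) auto
  then have compR: "compact R" unfolding R_def by (intro compact_Times) auto
  have zR: "(0, \<lambda>_. 0) \<in> R" using zero by (auto simp: R_def)
  obtain x where x: "x \<in> R" and xmin: "\<And>y. y \<in> R \<Longrightarrow> ?D (fst x) (snd x) \<le> ?D (fst y) (snd y)"
    using continuous_attains_inf[OF compR _ continuous_on_maxent_dual] zR by blast
  show ?thesis
  proof (rule that[of "snd x" "fst x"])
    have "snd x \<in> PiE UNIV (\<lambda>i. if i \<in> {m+1..<n} then {0..B} else if i = m then {-B..B} else {0})"
      using x by (auto simp: R_def)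
    then have "snd x i \<in> (if i \<in> {m+1..<n} then {0..B} else if i = m then {-B..B} else {0})" for i
      by (rule PiE_mem) simp
    then show "\<forall>i\<in>{m+1..<n}. 0 \<le> snd x i" by (metis atLeastAtMost_iff)
  next
    fix \<nu>' and lam' :: "nat \<Rightarrow> real" assume lam': "\<forall>i\<in>{m+1..<n}. 0 \<le> lam' i"
    show "?D (fst x) (snd x) \<le> ?D \<nu>' lam'"
    proof (cases "?D \<nu>' lam' \<le> K")
      case False
      then show ?thesis using xmin[OF zR] by (simp add: K_def)
    next
      case True
      define l where "l i = (if i \<in> {m..<n} then lam' i else 0)" for i
      have b: "\<bar>\<nu>'\<bar> \<le> B" "\<And>i. i \<in> {m..<n} \<Longrightarrow> \<bar>lam' i\<bar> \<le> B" using B[OF lam' True] by auto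
      have "(\<nu>', l) \<in> R"
        using b lam' mn by (auto simp: R_def l_def abs_le_iff minus_le_iff)
      then have "?D (fst x) (snd x) \<le> ?D \<nu>' l" using xmin by fastforce
      also have "\<dots> = ?D \<nu>' lam'"
        unfolding maxent_dual_def log_tilt_def l_def by simp
      finally show ?thesis .
    qed
  qed
qed

end

section \<open>First order conditions at a minimiser\<close>

lemma nonneg_if_quadratic_nonneg:
  fixes x \<delta> :: real
  assumes "\<delta> > 0" "\<And>t. 0 < t \<Longrightarrow> t \<le> \<delta> \<Longrightarrow> 0 \<le> t * x + t\<^sup>2"
  shows "0 \<le> x"
proof (rule ccontr)
  assume "\<not> 0 \<le> x"
  define t where "t = min \<delta> (- x / 2)"
  have t: "0 < t" "t \<le> \<delta>" "t + x < 0" using assms \<open>\<not> 0 \<le> x\<close> by (auto simp: t_def min_def)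
  have "t * x + t\<^sup>2 = t * (t + x)" by (simp add: power2_eq_square algebra_simps)
  also have "\<dots> < 0" using t by (simp add: mult_pos_neg)
  finally show False using assms(2)[OF t(1,2)] by simp
qed

text \<open>An explicit second order error for perturbed exponents. Together with the preceding
  lemma it takes the place of differentiation under the integral sign.\<close>

lemma exp_le_quadratic:
  fixes x :: real
  assumes "\<bar>x\<bar> \<le> 1"
  shows "exp x \<le> 1 + x + x\<^sup>2"
proof (cases "x \<ge> 0")
  case True
  then show ?thesis using assms exp_bound[of x] by simp
next
  case False
  have pos: "0 < 1 - x" using False by simp
  have "x ^ 3 \<le> 0" using False mult_nonneg_nonpos[of "x * x" x] by (simp add: power3_eq_cube)
  then have "1 \<le> (1 + x + x\<^sup>2) * (1 - x)" by (simp add: power2_eq_square power3_eq_cube algebra_simps)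
  also have "\<dots> \<le> (1 + x + x\<^sup>2) * exp (- x)"
  proof (intro mult_left_mono)
    have "1 + x + x\<^sup>2 \<ge> 0" using assms by (simp add: abs_le_iff add_nonneg_nonneg)
    then show "0 \<le> 1 + x + x\<^sup>2" .
    show "1 - x \<le> exp (- x)" using exp_ge_add_one_self[of "- x"] by simp
  qed
  finally have "1 * exp x \<le> (1 + x + x\<^sup>2) * exp (- x) * exp x" by (intro mult_right_mono) auto
  then show ?thesis by (simp add: mult.assoc exp_add[symmetric])
qed

lemma log_tilt_shift: "log_tilt m n h (\<nu> + t) lam s = t + log_tilt m n h \<nu> lam s"
  by (simp add: log_tilt_def)

lemma sum_fun_upd_add:
  fixes lam x :: "nat \<Rightarrow> real"
  assumes "i \<in> A" "finite A"
  shows "(\<Sum>j\<in>A. (lam(i := lam i + t)) j * x j) = (\<Sum>j\<in>A. lam j * x j) + t * x i"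
proof -
  have "(\<Sum>j\<in>A. (lam(i := lam i + t)) j * x j) = (\<Sum>j\<in>A. lam j * x j + (if j = i then t * x j else 0))"
    by (intro sum.cong) (auto simp: algebra_simps)
  then show ?thesis using assms by (simp add: sum.distrib)
qed

text \<open>These are the Karush-Kuhn-Tucker conditions. Varying \<open>\<nu>\<close> gives
  normalisation, raising \<open>lam i\<close> gives the moment inequality, and lowering it, possible
  for \<open>i = m\<close> or positive \<open>lam i\<close>, gives equality. Complementary slackness
  then turns the integral of \<open>log_tilt\<close> against the density into minus the dual
  value.\<close>

lemma maxent_dual_stationary:
  fixes m n :: nat and h \<alpha> lam :: "nat \<Rightarrow> real" and \<nu> :: real
  assumes mn: "m < n" and h: "\<And>k. k \<in> {1..n} \<Longrightarrow> h k > 0" and h1: "cumH h n = 1"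
    and lam: "\<forall>i\<in>{m+1..<n}. 0 \<le> lam i"
    and min: "\<And>\<nu>' lam'. \<forall>i\<in>{m+1..<n}. 0 \<le> lam' i \<Longrightarrow>
      maxent_dual m n h \<alpha> \<nu> lam \<le> maxent_dual m n h \<alpha> \<nu>' lam'"
  defines "f \<equiv> \<lambda>s. exp (log_tilt m n h \<nu> lam s)"
  defines "E \<equiv> \<lambda>i. integral {cumH h m..1} (\<lambda>s. max 0 (s - cumH h i) * f s)"
  shows "integral {cumH h m..1} f = 1" and "E m = mean_tail n h \<alpha> m"
    and "\<And>i. i \<in> {m..<n} \<Longrightarrow> E i \<le> mean_tail n h \<alpha> i"
    and "integral {cumH h m..1} (\<lambda>s. log_tilt m n h \<nu> lam s * f s) = - maxent_dual m n h \<alpha> \<nu> lam"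
proof -
  let ?a = "cumH h m" and ?c = "mean_tail n h \<alpha>"
  have a1: "?a < 1" using cumH_strict_mono[where h=h and i=m and j=n and n=n] h mn h1 by simp
  have H0: "0 \<le> cumH h i" if "i \<le> n" for i
    using cumH_mono[where h=h and i=0 and j=i and n=n] h that by simp
  have contf: "continuous_on A f" for A unfolding f_def by (intro continuous_intros)
  have int: "g integrable_on {?a..1}" if "continuous_on {?a..1} g" for g :: "real \<Rightarrow> real"
    using that by (rule integrable_continuous_interval)
  define I where "I = integral {?a..1} f"
  have "(1 - ?a) * exp (integral {?a..?a + (1 - ?a)} (log_tilt m n h \<nu> lam) / (1 - ?a)) \<le> I"
    using exp_average_le[of "1 - ?a" ?a "log_tilt m n h \<nu> lam"] a1 continuous_on_log_tilt
    by (simp add: I_def f_def)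
  then have Ipos: "I > 0" using a1 by (smt (verit) exp_gt_zero mult_pos_pos)
  \<comment> \<open>The shift by \<open>- ln I\<close> normalises the density. Minimality yields
    \<open>I \<le> ln I + 1\<close>, which holds only for \<open>I = 1\<close>.\<close>
  have "maxent_dual m n h \<alpha> \<nu> lam \<le> maxent_dual m n h \<alpha> (\<nu> + - ln I) lam"
    by (rule min[OF lam])
  moreover have "integral {?a..1} (\<lambda>s. exp (log_tilt m n h (\<nu> + - ln I) lam s)) = 1"
    using Ipos unfolding log_tilt_shift exp_add by (simp add: I_def f_def exp_minus)
  ultimately have "I \<le> ln I + 1"
    unfolding maxent_dual_def I_def f_def by simp
  then have I1: "I = 1" using ln_le_minus_one[OF Ipos] ln_eq_minus_one[OF Ipos] by linarith
  then show "integral {?a..1} f = 1" by (simp add: I_def)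
  \<comment> \<open>\<open>?c i - E i\<close> is the derivative of the dual in \<open>lam i\<close>.
    The error is at most \<open>t\<^sup>2\<close> because the hinge is at most 1 on the range and
    the density has mass 1.\<close>
  have var: "0 \<le> t * (?c i - E i) + t\<^sup>2"
    if i: "i \<in> {m..<n}" and t: "\<bar>t\<bar> \<le> 1" and feas: "i = m \<or> 0 \<le> lam i + t" for i t
  proof -
    let ?l = "lam(i := lam i + t)"
    have "\<forall>j\<in>{m+1..<n}. 0 \<le> ?l j" using lam feas by auto
    then have "maxent_dual m n h \<alpha> \<nu> lam \<le> maxent_dual m n h \<alpha> \<nu> ?l" by (rule min)
    moreover have "(\<Sum>j=m..<n. ?l j * ?c j) = (\<Sum>j=m..<n. lam j * ?c j) + t * ?c i"
      using i by (intro sum_fun_upd_add) auto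
    ultimately have "1 \<le> t * ?c i + integral {?a..1} (\<lambda>s. exp (log_tilt m n h \<nu> ?l s))"
      using I1 unfolding maxent_dual_def I_def f_def by simp
    also have "integral {?a..1} (\<lambda>s. exp (log_tilt m n h \<nu> ?l s))
        \<le> integral {?a..1} (\<lambda>s. (1 + t\<^sup>2) * f s - t * (max 0 (s - cumH h i) * f s))"
    proof (intro integral_le int continuous_intros contf)
      fix s assume s: "s \<in> {?a..1}"
      let ?y = "max 0 (s - cumH h i)"
      have y: "0 \<le> ?y" "?y \<le> 1" using s H0[of i] i by auto
      have ty: "\<bar>- (t * ?y)\<bar> \<le> 1" using t y mult_mono[of "\<bar>t\<bar>" 1 ?y 1] by (simp add: abs_mult)
      have "(t * ?y)\<^sup>2 \<le> t\<^sup>2 * 1"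
        unfolding power_mult_distrib using y by (intro mult_left_mono) (auto simp: power_le_one)
      then have "exp (- (t * ?y)) \<le> 1 - t * ?y + t\<^sup>2"
        using exp_le_quadratic[OF ty] by simp
      then have "exp (- (t * ?y)) * f s \<le> (1 - t * ?y + t\<^sup>2) * f s"
        by (intro mult_right_mono) (auto simp: f_def)
      moreover have "log_tilt m n h \<nu> ?l s = - (t * ?y) + log_tilt m n h \<nu> lam s"
        unfolding log_tilt_def using i by (subst sum_fun_upd_add) auto
      then have "exp (log_tilt m n h \<nu> ?l s) = exp (- (t * ?y)) * f s"
        by (simp only: exp_add f_def)
      ultimately show "exp (log_tilt m n h \<nu> ?l s) \<le> (1 + t\<^sup>2) * f s - t * (?y * f s)"
        by (simp add: algebra_simps)
    qed
    also have "\<dots> = (1 + t\<^sup>2) * I - t * E i"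
      unfolding I_def E_def
      by (subst integral_diff) (auto intro!: int continuous_intros contf)
    finally show ?thesis using I1 by (simp add: algebra_simps)
  qed
  have le: "E i \<le> ?c i" if i: "i \<in> {m..<n}" for i
  proof -
    have "0 \<le> ?c i - E i"
    proof (rule nonneg_if_quadratic_nonneg[of 1])
      fix t :: real assume t: "0 < t" "t \<le> 1"
      then show "0 \<le> t * (?c i - E i) + t\<^sup>2"
        using lam i by (intro var) (auto intro!: add_nonneg_nonneg)
    qed simp
    then show ?thesis by simp
  qed
  have ge: "?c i \<le> E i" if i: "i \<in> {m..<n}" and act: "i = m \<or> lam i > 0" for i
  proof -
    have "0 \<le> E i - ?c i"
    \<comment> \<open>Lowering \<open>lam i\<close> by at most its own value keeps it nonnegative;
      \<open>lam m\<close> is free.\<close>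
    proof (rule nonneg_if_quadratic_nonneg[of "if i = m then 1 else min 1 (lam i)"])
      show "(if i = m then 1 else min 1 (lam i)) > 0" using act by auto
      fix t :: real assume "0 < t" "t \<le> (if i = m then 1 else min 1 (lam i))"
      then have "0 \<le> (- t) * (?c i - E i) + (- t)\<^sup>2"
        by (intro var[OF i]) (auto split: if_splits)
      then show "0 \<le> t * (E i - ?c i) + t\<^sup>2" by (simp add: algebra_simps)
    qed
    then show ?thesis by simp
  qed
  show "E m = ?c m" using le[of m] ge[of m] mn by auto
  show "E i \<le> ?c i" if "i \<in> {m..<n}" for i using le[OF that] .
  have comp: "lam i * E i = lam i * ?c i" if i: "i \<in> {m..<n}" for i
  proof (cases "i = m \<or> lam i > 0")
    case True
    then show ?thesis using le[OF i] ge[OF i] by auto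
  next
    case False
    then have "i \<in> {m+1..<n}" using i by auto
    then have "0 \<le> lam i" using lam by blast
    then have "lam i = 0" using False by simp
    then show ?thesis by simp
  qed
  have "integral {?a..1} (\<lambda>s. log_tilt m n h \<nu> lam s * f s)
      = integral {?a..1} (\<lambda>s. \<nu> * f s - (\<Sum>i=m..<n. lam i * (max 0 (s - cumH h i) * f s)))"
    by (simp add: log_tilt_def left_diff_distrib sum_distrib_right mult.assoc)
  also have "\<dots> = integral {?a..1} (\<lambda>s. \<nu> * f s)
      - integral {?a..1} (\<lambda>s. \<Sum>i=m..<n. lam i * (max 0 (s - cumH h i) * f s))"
    by (intro integral_diff int continuous_intros contf)
  also have "\<dots> = \<nu> * I - (\<Sum>i=m..<n. lam i * E i)"
    unfolding I_def E_def by (subst integral_sum) (auto intro!: int continuous_intros contf)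
  also have "(\<Sum>i=m..<n. lam i * E i) = (\<Sum>i=m..<n. lam i * ?c i)"
    by (intro sum.cong refl comp)
  finally show "integral {?a..1} (\<lambda>s. log_tilt m n h \<nu> lam s * f s) = - maxent_dual m n h \<alpha> \<nu> lam"
    using I1 unfolding maxent_dual_def I_def f_def by simp
qed

section \<open>The boundary case \<open>\<alpha> 1 = 1\<close>\<close>

lemma log_tilt_0_eq_log_tilt_1:
  assumes "n \<ge> 2" and s: "0 \<le> s" "h 1 \<le> s"
  shows "log_tilt 0 n h \<nu> lam s = log_tilt 1 n h (\<nu> - lam 0 * h 1) (lam(1 := lam 0 + lam 1)) s"
proof -
  have split: "sum g {0..<n} = g 0 + g 1 + sum g {2..<n}" "sum g {1..<n} = g 1 + sum g {2..<n}"
    for g :: "nat \<Rightarrow> real"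
    using \<open>n \<ge> 2\<close> by (simp_all add: sum.atLeast_Suc_lessThan numeral_2_eq_2)
  \<comment> \<open>Past \<open>h 1\<close> the first two hinges are both affine and merge:
    \<open>lam 0 * s + lam 1 * (s - h 1) = lam 0 * h 1 + (lam 0 + lam 1) * (s - h
    1)\<close>.\<close>
  have "cumH h 1 = h 1" by (simp add: cumH_def)
  then show ?thesis
    unfolding log_tilt_def split using s by (simp add: max_def algebra_simps)
qed

text \<open>After this change of parameters the two duals differ exactly by the integral over the
  first cell. It is nonnegative, and a steep slope \<open>t\<close> on that cell makes it as small
  as desired without changing the rest, so the infima agree while only the reduced one is
  attained.\<close>

lemma maxent_dual_1_le_maxent_dual_0:
  assumes n: "n \<ge> 2" and h: "\<And>k. k \<in> {1..n} \<Longrightarrow> h k > 0" and h1: "cumH h n = 1" and \<alpha>1: "\<alpha> 1 = 1"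
  shows "maxent_dual 1 n h \<alpha> (\<nu> - lam 0 * h 1) (lam(1 := lam 0 + lam 1)) \<le> maxent_dual 0 n h \<alpha> \<nu> lam"
    and "\<lbrakk>t > 0; \<mu> = lam 1 + t\<rbrakk> \<Longrightarrow> maxent_dual 0 n h \<alpha> (\<nu> - t * h 1) (lam(0 := - t, 1 := \<mu>))
      \<le> maxent_dual 1 n h \<alpha> \<nu> lam + exp \<nu> / t"
proof -
  let ?c = "mean_tail n h \<alpha>"
  have H1: "cumH h 1 = h 1" by (simp add: cumH_def)
  have h1b: "0 < h 1" "h 1 \<le> 1"
    using h[of 1] n cumH_mono[where h=h and i=1 and j=n and n=n] h h1 H1 by auto
  have split: "sum g {0..<n} = g 0 + g 1 + sum g {2..<n}" "sum g {1..<n} = g 1 + sum g {2..<n}"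
    for g :: "nat \<Rightarrow> real"
    using n by (simp_all add: sum.atLeast_Suc_lessThan numeral_2_eq_2)
  \<comment> \<open>Here \<open>\<alpha> 1 = 1\<close> enters; it makes the linear parts of the two
    duals agree.\<close>
  have c0: "?c 0 = h 1 + ?c 1"
    unfolding mean_tail_def using n \<alpha>1 by (simp add: sum.atLeast_Suc_atMost numeral_2_eq_2)
  have lin: "(\<Sum>i=0..<n. lam i * ?c i) - \<nu>
      = (\<Sum>i=1..<n. (lam(1 := lam 0 + lam 1)) i * ?c i) - (\<nu> - lam 0 * h 1)" for \<nu> lam
    unfolding split c0 by (simp add: algebra_simps)
  have dual: "maxent_dual 0 n h \<alpha> \<nu> lam = integral {0..h 1} (\<lambda>s. exp (log_tilt 0 n h \<nu> lam s))
      + maxent_dual 1 n h \<alpha> (\<nu> - lam 0 * h 1) (lam(1 := lam 0 + lam 1))" for \<nu> lam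
  proof -
    have "integral {0..1} (\<lambda>s. exp (log_tilt 0 n h \<nu> lam s))
        = integral {0..h 1} (\<lambda>s. exp (log_tilt 0 n h \<nu> lam s))
        + integral {h 1..1} (\<lambda>s. exp (log_tilt 0 n h \<nu> lam s))"
      using h1b by (intro Henstock_Kurzweil_Integration.integral_combine[symmetric] integrable_exp_log_tilt) auto
    also have "integral {h 1..1} (\<lambda>s. exp (log_tilt 0 n h \<nu> lam s))
        = integral {h 1..1} (\<lambda>s. exp (log_tilt 1 n h (\<nu> - lam 0 * h 1) (lam(1 := lam 0 + lam 1)) s))"
      using n h1b by (intro integral_cong) (subst log_tilt_0_eq_log_tilt_1, auto)
    finally show ?thesis
      unfolding maxent_dual_def H1 cumH_0 using lin[of lam \<nu>] by linarith
  qed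
  show "maxent_dual 1 n h \<alpha> (\<nu> - lam 0 * h 1) (lam(1 := lam 0 + lam 1)) \<le> maxent_dual 0 n h \<alpha> \<nu> lam"
    unfolding dual[of \<nu> lam] using integral_nonneg[OF integrable_exp_log_tilt] by simp
  assume t: "t > 0" and \<mu>: "\<mu> = lam 1 + t"
  let ?l = "lam(0 := - t, 1 := \<mu>)"
  have "integral {0..h 1} (\<lambda>s. exp (log_tilt 0 n h (\<nu> - t * h 1) ?l s))
      = integral {0..h 1} (\<lambda>s. exp (\<nu> - t * h 1 + t * s))"
  proof (intro integral_cong)
    fix s assume s: "s \<in> {0..h 1}"
    have "sum (\<lambda>i. ?l i * max 0 (s - cumH h i)) {0..<n} = (\<Sum>i\<in>{0..<n}. if i = 0 then - t * s else 0)"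
    proof (intro sum.cong refl)
      fix i assume i: "i \<in> {0..<n}"
      show "?l i * max 0 (s - cumH h i) = (if i = 0 then - t * s else 0)"
      proof (cases "i = 0")
        case False
        then have "h 1 \<le> cumH h i"
          using cumH_mono[where h=h and i=1 and j=i and n=n] h i H1 by auto
        then show ?thesis using s False by (simp add: max_def)
      qed (use s in simp)
    qed
    also have "\<dots> = - t * s" using n by simp
    finally show "exp (log_tilt 0 n h (\<nu> - t * h 1) ?l s) = exp (\<nu> - t * h 1 + t * s)"
      unfolding log_tilt_def by simp
  qed
  also have "\<dots> = exp (\<nu> - t * h 1) * (h 1 * zeta_fn (t * h 1))"
    using integral_exp_affine[of "h 1" 0 "\<nu> - t * h 1" t] h1b by simp
  also have "\<dots> = (exp \<nu> - exp (\<nu> - t * h 1)) / t"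
  proof -
    have "exp (\<nu> - t * h 1) * exp (t * h 1) = exp \<nu>" by (simp add: exp_add[symmetric])
    moreover have "exp (\<nu> - t * h 1) * (h 1 * zeta_fn (t * h 1))
        = (exp (\<nu> - t * h 1) * exp (t * h 1) - exp (\<nu> - t * h 1)) / t"
      using t h1b by (simp add: zeta_fn_def field_simps)
    ultimately show ?thesis by simp
  qed
  also have "\<dots> \<le> exp \<nu> / t" using t by (intro divide_right_mono) auto
  finally have "integral {0..h 1} (\<lambda>s. exp (log_tilt 0 n h (\<nu> - t * h 1) ?l s)) \<le> exp \<nu> / t" .
  \<comment> \<open>The reparametrisation undoes the choice of \<open>?l\<close>: the shifts by
    \<open>t * h 1\<close> cancel, and the entry at 1 returns to \<open>lam 1\<close>.\<close>
  moreover have "maxent_dual 1 n h \<alpha> (\<nu> - t * h 1 - ?l 0 * h 1) (?l(1 := ?l 0 + ?l 1)) = maxent_dual 1 n h \<alpha> \<nu> lam"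
    unfolding maxent_dual_def log_tilt_def split using \<mu> by simp
  ultimately show "maxent_dual 0 n h \<alpha> (\<nu> - t * h 1) ?l \<le> maxent_dual 1 n h \<alpha> \<nu> lam + exp \<nu> / t"
    unfolding dual[of "\<nu> - t * h 1" ?l] by linarith
qed

section \<open>Transporting a Gaussian to a given density\<close>

text \<open>Exhausts the line by compact intervals and passes to the limit by monotone convergence.
  The indicator is present because an increasing map may have a bounded range, as the transport
  below does.\<close>

lemma nn_integral_substitution_range:
  fixes g g' :: "real \<Rightarrow> real" and f :: "real \<Rightarrow> ennreal"
  assumes [measurable]: "f \<in> borel_measurable borel"
    and deriv: "\<And>x. (g has_real_derivative g' x) (at x)"
    and cont: "continuous_on UNIV g'"
    and pos: "\<And>x. g' x > 0"
  shows "(\<integral>\<^sup>+x. f (g x) * ennreal (g' x) \<partial>lborel) = (\<integral>\<^sup>+y. f y * indicator (range g) y \<partial>lborel)"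
proof -
  have smono: "g x < g y" if "x < y" for x y
    using that deriv pos by (metis DERIV_pos_imp_increasing)
  have contg: "continuous_on UNIV g"
    by (auto intro!: continuous_at_imp_continuous_on DERIV_isCont[OF deriv])
  have [measurable]: "g \<in> borel_measurable borel" "g' \<in> borel_measurable borel"
    using contg cont by (auto intro: borel_measurable_continuous_onI)
  have step: "(\<integral>\<^sup>+y. f y * indicator {g (- real (Suc n))..g (real (Suc n))} y \<partial>lborel) =
      (\<integral>\<^sup>+x. f (g x) * ennreal (g' x) * indicator {- real (Suc n)..real (Suc n)} x \<partial>lborel)" for n
    by (rule nn_integral_substitution_aux)
       (use deriv pos cont less_imp_le in \<open>auto intro: continuous_on_subset\<close>)
  have un: "(SUP n. indicator {- real (Suc n)..real (Suc n)} x) = (1::ennreal)" for x :: real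
  proof -
    obtain n where "\<bar>x\<bar> \<le> real n" using real_arch_simple by blast
    then have "indicator {- real (Suc n)..real (Suc n)} x = (1::ennreal)"
      by (simp add: indicator_def abs_le_iff)
    then show ?thesis
      by (intro antisym SUP_least SUP_upper2[where i=n]) (auto simp: indicator_def)
  qed
  have ug: "(SUP n. indicator {g (- real (Suc n))..g (real (Suc n))} y) = (indicator (range g) y::ennreal)" for y
  proof (cases "y \<in> range g")
    case True
    then obtain x where x: "y = g x" by auto
    obtain n where "\<bar>x\<bar> \<le> real n" using real_arch_simple by blast
    then have "g (- real (Suc n)) \<le> y" "y \<le> g (real (Suc n))"
      unfolding x using smono by (auto intro!: less_imp_le)
    then have "indicator {g (- real (Suc n))..g (real (Suc n))} y = (1::ennreal)" by auto
    then show ?thesis using True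
      by (intro antisym SUP_least SUP_upper2[where i=n]) (auto simp: indicator_def)
  next
    case False
    have "y \<notin> {g (- real (Suc n))..g (real (Suc n))}" for n
    proof
      assume "y \<in> {g (- real (Suc n))..g (real (Suc n))}"
      then have "\<exists>x. - real (Suc n) \<le> x \<and> x \<le> real (Suc n) \<and> g x = y"
        by (intro IVT') (auto intro: continuous_on_subset[OF contg])
      with False show False by auto
    qed
    then have "indicator {g (- real (Suc n))..g (real (Suc n))} y = (0::ennreal)" for n
      by (simp only: indicator_def of_bool_eq)
    with False show ?thesis by simp
  qed
  have "(\<integral>\<^sup>+x. f (g x) * ennreal (g' x) \<partial>lborel)
      = (\<integral>\<^sup>+x. (SUP n. f (g x) * ennreal (g' x) * indicator {- real (Suc n)..real (Suc n)} x) \<partial>lborel)"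
    by (simp only: SUP_mult_left_ennreal[symmetric] un mult_1_right)
  also have "\<dots> = (SUP n. \<integral>\<^sup>+x. f (g x) * ennreal (g' x) * indicator {- real (Suc n)..real (Suc n)} x \<partial>lborel)"
    by (intro nn_integral_monotone_convergence_SUP)
       (auto simp: incseq_Suc_iff le_fun_def indicator_def)
  also have "\<dots> = (SUP n. \<integral>\<^sup>+y. f y * indicator {g (- real (Suc n))..g (real (Suc n))} y \<partial>lborel)"
    by (simp only: step)
  also have "\<dots> = (\<integral>\<^sup>+y. (SUP n. f y * indicator {g (- real (Suc n))..g (real (Suc n))} y) \<partial>lborel)"
  proof (intro nn_integral_monotone_convergence_SUP[symmetric])
    show "incseq (\<lambda>n y. f y * indicator {g (- real (Suc n))..g (real (Suc n))} y)"
      unfolding incseq_Suc_iff le_fun_def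
    proof (intro allI mult_left_mono indicator_leI)
      fix n y assume "y \<in> {g (- real (Suc n))..g (real (Suc n))}"
      moreover have "g (- real (Suc (Suc n))) < g (- real (Suc n))" "g (real (Suc n)) < g (real (Suc (Suc n)))"
        by (rule smono, simp)+
      ultimately show "y \<in> {g (- real (Suc (Suc n)))..g (real (Suc (Suc n)))}" by auto
    qed auto
  qed auto
  also have "\<dots> = (\<integral>\<^sup>+y. f y * indicator (range g) y \<partial>lborel)"
    by (simp only: SUP_mult_left_ennreal[symmetric] ug)
  finally show ?thesis .
qed

abbreviation std_gauss :: "real measure" where
  "std_gauss \<equiv> density lborel (\<lambda>x. ennreal (std_normal_density x))"

lemma std_gauss_cdf:
  obtains \<Phi> :: "real \<Rightarrow> real" where
    "\<And>x. (\<Phi> has_real_derivative std_normal_density x) (at x)"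
    "\<And>x. 0 < \<Phi> x" "\<And>x. \<Phi> x < 1" "\<And>u. 0 < u \<Longrightarrow> u < 1 \<Longrightarrow> \<exists>x. \<Phi> x = u"
proof -
  interpret N: prob_space std_gauss by (rule prob_space_normal_density) simp
  interpret N: real_distribution std_gauss
    by standard auto
  have contn: "continuous_on S std_normal_density" for S
    unfolding normal_density_def by (intro continuous_intros) auto
  have diff: "cdf std_gauss y - cdf std_gauss x = integral {x..y} std_normal_density" if "x < y" for x y
  proof -
    have "cdf std_gauss y - cdf std_gauss x = measure std_gauss {x<..y}"
      using N.cdf_diff_eq[OF that] .
    also have "\<dots> = enn2real (\<integral>\<^sup>+t. ennreal (std_normal_density t * indicator {x<..y} t) \<partial>lborel)"
      by (simp add: measure_def emeasure_density ennreal_mult'' ennreal_indicator)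
    also have "\<dots> = (\<integral>t. std_normal_density t * indicator {x<..y} t \<partial>lborel)"
      by (subst integral_eq_nn_integral) auto
    also have "\<dots> = (\<integral>t. indicator {x..y} t *\<^sub>R std_normal_density t \<partial>lborel)"
      by (rule integral_cong_AE) (auto intro!: AE_I[where N="{x}"] simp: indicator_def)
    also have "\<dots> = integral {x..y} std_normal_density"
      by (subst set_borel_integral_eq_integral(2)[unfolded set_lebesgue_integral_def])
         (auto intro!: borel_integrable_atLeastAtMost' contn)
    finally show ?thesis .
  qed
  have deriv: "(cdf std_gauss has_real_derivative std_normal_density x) (at x)" for x
  proof -
    have "((\<lambda>y. cdf std_gauss (x - 1) + integral {x - 1..y} std_normal_density)
        has_real_derivative std_normal_density x) (at x within {x - 1..x + 1})"
      by (auto intro!: derivative_eq_intros integral_has_real_derivative contn)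
    then have "((\<lambda>y. cdf std_gauss (x - 1) + integral {x - 1..y} std_normal_density)
        has_real_derivative std_normal_density x) (at x)"
      by (subst (asm) at_within_Icc_at) auto
    then show ?thesis
    proof (rule DERIV_cong_ev[THEN iffD1, rotated -1])
      show "\<forall>\<^sub>F y in nhds x. cdf std_gauss (x - 1) + integral {x - 1..y} std_normal_density = cdf std_gauss y"
        using eventually_nhds_in_open[of "{x-1<..}" x]
        by (auto elim!: eventually_mono simp: diff[symmetric])
    qed auto
  qed
  have smono: "cdf std_gauss x < cdf std_gauss y" if "x < y" for x y
    using that deriv normal_density_pos by (metis DERIV_pos_imp_increasing zero_less_one)
  have cont: "isCont (cdf std_gauss) x" for x using deriv DERIV_isCont by blast
  have sur: "\<exists>x. cdf std_gauss x = u" if "0 < u" "u < 1" for u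
  proof -
    have "\<forall>\<^sub>F x in at_bot. cdf std_gauss x < u" "\<forall>\<^sub>F x in at_top. u < cdf std_gauss x"
      using N.cdf_lim_at_bot N.cdf_lim_at_top_prob that by (auto dest: order_tendstoD)
    then obtain x y where xy: "cdf std_gauss x < u" "u < cdf std_gauss y"
      using eventually_happens by (metis trivial_limit_at_bot_linorder trivial_limit_at_top_linorder)
    then have "x \<le> y" using smono by (meson less_imp_le less_trans not_le order.asym)
    with xy show ?thesis
      using IVT[of "cdf std_gauss" x u y] cont by auto
  qed
  show ?thesis
  proof (rule that[of "cdf std_gauss"])
    show "0 < cdf std_gauss x" for x
      using smono[of "x-1" x] N.cdf_nonneg[of "x-1"] by linarith
    show "cdf std_gauss x < 1" for x
      using smono[of x "x+1"] N.cdf_bounded_prob[of "x+1"] by linarith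
  qed (use deriv sur in auto)
qed

text \<open>\<open>T\<close> is the quantile function of the target law after the normal
  distribution function, and its derivative comes from the inverse function rule. The endpoints are
  never reached because the normal distribution function stays strictly between 0 and 1.\<close>

lemma gauss_transport_exists:
  fixes a b :: real and f :: "real \<Rightarrow> real"
  assumes ab: "a < b" and contf: "continuous_on {a..b} f"
    and pos: "\<And>x. x \<in> {a..b} \<Longrightarrow> f x > 0" and int1: "integral {a..b} f = 1"
  obtains T where "\<And>x. (T has_real_derivative std_normal_density x / f (T x)) (at x)"
    and "range T = {a<..<b}"
proof -
  obtain \<Phi> :: "real \<Rightarrow> real" where \<Phi>: "\<And>x. (\<Phi> has_real_derivative std_normal_density x) (at x)"
    "\<And>x. 0 < \<Phi> x" "\<And>x. \<Phi> x < 1" "\<And>u. 0 < u \<Longrightarrow> u < 1 \<Longrightarrow> \<exists>x. \<Phi> x = u"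
    using std_gauss_cdf by metis
  define F where "F = (\<lambda>t. integral {a..t} f)"
  have Fd: "(F has_real_derivative f t) (at t within {a..b})" if "t \<in> {a..b}" for t
    unfolding F_def using contf that by (rule integral_has_real_derivative)
  have contF: "continuous_on {a..b} F"
    using Fd DERIV_continuous_on by blast
  have Fd': "(F has_real_derivative f t) (at t)" if "t \<in> {a<..<b}" for t
    using Fd[of t] that by (simp add: at_within_Icc_at)
  have F0: "F a = 0" and F1: "F b = 1" using int1 by (auto simp: F_def)
  have smono: "F s < F t" if "a \<le> s" "s < t" "t \<le> b" for s t
  proof (rule DERIV_pos_imp_increasing_open[OF \<open>s < t\<close>])
    show "\<exists>y. (F has_real_derivative y) (at x) \<and> 0 < y" if "s < x" "x < t" for x
      using Fd'[of x] pos[of x] that \<open>a \<le> s\<close> \<open>t \<le> b\<close> by auto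
  qed (use that in \<open>auto intro: continuous_on_subset[OF contF]\<close>)
  have inj: "inj_on F {a..b}"
    by (rule linorder_inj_onI) (use smono in force)+
  have img: "F ` {a..b} = {0..1}"
  proof (intro equalityI subsetI)
    fix u assume "u \<in> F ` {a..b}"
    then obtain t where "t \<in> {a..b}" "u = F t" by auto
    then show "u \<in> {0..1}" using smono[of a t] smono[of t b] F0 F1 by (cases "t = a"; cases "t = b") force+
  next
    fix u :: real assume "u \<in> {0..1}"
    then show "u \<in> F ` {a..b}" using IVT'[of F a u b] F0 F1 ab contF by force
  qed
  define G where "G = inv_into {a..b} F"
  have FG: "F (G u) = u" "G u \<in> {a..b}" if "u \<in> {0..1}" for u
    using that unfolding G_def img[symmetric] by (rule f_inv_into_f, rule inv_into_into)
  have GF: "G (F t) = t" if "t \<in> {a..b}" for t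
    using that inj by (simp add: G_def)
  have contG: "continuous_on {0..1} G"
    unfolding img[symmetric] by (rule continuous_on_inv[OF contF]) (auto simp: GF)
  have Gin: "G u \<in> {a<..<b}" if "0 < u" "u < 1" for u
  proof -
    have "G u \<noteq> a" "G u \<noteq> b" using FG[of u] F0 F1 that by auto
    then show ?thesis using FG(2)[of u] that by auto
  qed
  have Gd: "(G has_real_derivative inverse (f (G u))) (at u)" if "0 < u" "u < 1" for u
  proof (rule DERIV_inverse_function[of F _ _ _ 0 1])
    show "(F has_real_derivative f (G u)) (at (G u))" using Fd' Gin that by blast
    show "f (G u) \<noteq> 0" using pos[of "G u"] Gin[of u] that by auto
    show "isCont G u" using contG that
      by (metis continuous_on_interior interior_atLeastAtMost_real greaterThanLessThan_iff)
  qed (use that FG in auto)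
  show ?thesis
  proof (rule that[of "G \<circ> \<Phi>"])
    show "(G \<circ> \<Phi> has_real_derivative std_normal_density x / f ((G \<circ> \<Phi>) x)) (at x)" for x
      using DERIV_chain[OF Gd \<Phi>(1), of x] \<Phi>(2,3)[of x] by (simp add: field_simps)
    show "range (G \<circ> \<Phi>) = {a<..<b}"
    proof (intro equalityI subsetI)
      fix t assume t: "t \<in> {a<..<b}"
      then have "0 < F t" "F t < 1" using smono[of a t] smono[of t b] F0 F1 by auto
      then obtain x where "\<Phi> x = F t" using \<Phi>(4) by blast
      then show "t \<in> range (G \<circ> \<Phi>)" using GF[of t] t by (auto intro!: image_eqI[of _ _ x])
    qed (use Gin \<Phi> in force)
  qed
qed

text \<open>The hypothesis on the derivative says
  \<open>f (T x) * T' x = std_normal_density x\<close>, the one-dimensional Monge-Ampere equation;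
  substitution turns it into equality of laws.\<close>

lemma gauss_transport_distr:
  fixes T f :: "real \<Rightarrow> real"
  assumes contf: "continuous_on {a..b} f"
    and pos: "\<And>x. x \<in> {a..b} \<Longrightarrow> f x > 0"
    and T: "\<And>x. (T has_real_derivative std_normal_density x / f (T x)) (at x)"
    and rng: "range T = {a<..<b}"
  shows "distr std_gauss borel T = density lborel (\<lambda>y. ennreal (indicator {a<..<b} y * f y))"
proof (rule measure_eqI)
  have Tin: "T x \<in> {a<..<b}" for x using rng by blast
  have contT: "continuous_on UNIV T"
    by (auto intro!: continuous_at_imp_continuous_on DERIV_isCont[OF T])
  have contfT: "continuous_on UNIV (\<lambda>x. f (T x))"
    by (rule continuous_on_compose2[OF contf contT]) (use Tin in \<open>auto simp: less_imp_le\<close>)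
  have contn: "continuous_on UNIV std_normal_density"
    unfolding normal_density_def by (intro continuous_intros) auto
  have fT: "f (T x) > 0" for x using pos Tin by (auto simp: less_imp_le)
  have fTne: "f (T x) \<noteq> 0" for x using fT[of x] by simp
  have [measurable]: "T \<in> borel_measurable borel"
    using contT by (intro borel_measurable_continuous_onI)
  have "continuous_on {a<..<b} f" by (rule continuous_on_subset[OF contf]) auto
  then have "(\<lambda>y. indicator {a<..<b} y *\<^sub>R f y) \<in> borel_measurable borel"
    by (intro borel_measurable_continuous_on_indicator) auto
  then have [measurable]: "(\<lambda>y. indicator {a<..<b} y * f y) \<in> borel_measurable borel" by simp
  show "sets (distr std_gauss borel T) = sets (density lborel (\<lambda>y. ennreal (indicator {a<..<b} y * f y)))"
    by simp
  fix A assume "A \<in> sets (distr std_gauss borel T)"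
  then have [measurable]: "A \<in> sets borel" by simp
  have "emeasure (distr std_gauss borel T) A = (\<integral>\<^sup>+x. indicator A (T x) \<partial>std_gauss)"
    by (subst nn_integral_distr[symmetric, where M'=borel]) auto
  also have "\<dots> = (\<integral>\<^sup>+x. ennreal (std_normal_density x) * indicator A (T x) \<partial>lborel)"
    by (subst nn_integral_density) auto
  also have "\<dots> = (\<integral>\<^sup>+x. (\<lambda>y. ennreal (indicator {a<..<b} y * f y) * indicator A y) (T x)
      * ennreal (std_normal_density x / f (T x)) \<partial>lborel)"
  proof (rule nn_integral_cong)
    fix x
    have "ennreal (f (T x)) * ennreal (std_normal_density x / f (T x)) = ennreal (std_normal_density x)"
      using fT[of x] by (subst ennreal_mult[symmetric]) auto
    then show "ennreal (std_normal_density x) * indicator A (T x) =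
      (\<lambda>y. ennreal (indicator {a<..<b} y * f y) * indicator A y) (T x)
      * ennreal (std_normal_density x / f (T x))"
      using Tin[of x] by (cases "T x \<in> A") simp_all
  qed
  also have "\<dots> = (\<integral>\<^sup>+y. ennreal (indicator {a<..<b} y * f y) * indicator A y * indicator (range T) y \<partial>lborel)"
    by (rule nn_integral_substitution_range)
       (use T fT fTne normal_density_pos in \<open>auto intro!: continuous_on_divide contfT contn\<close>)
  also have "\<dots> = (\<integral>\<^sup>+y. ennreal (indicator {a<..<b} y * f y) * indicator A y \<partial>lborel)"
    unfolding rng by (intro nn_integral_cong) (auto simp: indicator_def)
  also have "\<dots> = emeasure (density lborel (\<lambda>y. ennreal (indicator {a<..<b} y * f y))) A"
    by (subst emeasure_density) auto
  finally show "emeasure (distr std_gauss borel T) A = \<dots>" .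
qed

lemma gauss_transport_expectation:
  fixes T f \<psi> :: "real \<Rightarrow> real"
  assumes contf: "continuous_on {a..b} f"
    and pos: "\<And>x. x \<in> {a..b} \<Longrightarrow> f x > 0"
    and T: "\<And>x. (T has_real_derivative std_normal_density x / f (T x)) (at x)"
    and rng: "range T = {a<..<b}" and cont\<psi>: "continuous_on UNIV \<psi>"
  shows "(\<integral>x. \<psi> (T x) \<partial>std_gauss) = integral {a..b} (\<lambda>s. \<psi> s * f s)"
    and "integrable std_gauss (\<lambda>x. \<psi> (T x))"
proof -
  have contT: "continuous_on UNIV T"
    by (auto intro!: continuous_at_imp_continuous_on DERIV_isCont[OF T])
  have [measurable]: "T \<in> borel_measurable borel" "\<psi> \<in> borel_measurable borel"
    using contT cont\<psi> by (auto intro: borel_measurable_continuous_onI)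
  have "continuous_on {a<..<b} f" by (rule continuous_on_subset[OF contf]) auto
  then have "(\<lambda>y. indicator {a<..<b} y *\<^sub>R f y) \<in> borel_measurable borel"
    by (intro borel_measurable_continuous_on_indicator) auto
  then have [measurable]: "(\<lambda>y. indicator {a<..<b} y * f y) \<in> borel_measurable borel" by simp
  have D: "distr std_gauss borel T = density lborel (\<lambda>y. ennreal (indicator {a<..<b} y * f y))"
    by (rule gauss_transport_distr[OF contf pos T rng])
  have nn: "0 \<le> indicator {a<..<b} y * f y" for y
    using pos[of y] by (auto simp: indicator_def)
  have si: "set_integrable lborel {a..b} (\<lambda>s. \<psi> s * f s)"
    by (intro borel_integrable_atLeastAtMost' continuous_on_mult contf continuous_on_subset[OF cont\<psi>]) auto
  have ae: "AE y in lborel. indicator {a..b} y *\<^sub>R (\<psi> y * f y) = indicator {a<..<b} y * f y * \<psi> y"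
    by (rule AE_I[where N="{a, b}"]) (auto simp: indicator_def emeasure_lborel_countable)
  have m: "(\<lambda>y. indicator {a..b} y *\<^sub>R (\<psi> y * f y)) \<in> borel_measurable lborel"
    using si by (simp add: set_integrable_def)
  have "(\<integral>x. \<psi> (T x) \<partial>std_gauss) = (\<integral>y. \<psi> y \<partial>distr std_gauss borel T)"
    by (subst integral_distr) auto
  also have "\<dots> = (\<integral>y. indicator {a<..<b} y * f y * \<psi> y \<partial>lborel)"
    unfolding D by (subst integral_density) (use nn in auto)
  also have "\<dots> = (\<integral>y. indicator {a..b} y *\<^sub>R (\<psi> y * f y) \<partial>lborel)"
    by (rule integral_cong_AE) (use ae m in auto)
  also have "\<dots> = integral {a..b} (\<lambda>s. \<psi> s * f s)"
    using set_borel_integral_eq_integral(2)[OF si] by (simp add: set_lebesgue_integral_def)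
  finally show "(\<integral>x. \<psi> (T x) \<partial>std_gauss) = integral {a..b} (\<lambda>s. \<psi> s * f s)" .
  have "integrable lborel (\<lambda>y. indicator {a<..<b} y * f y * \<psi> y)"
    using si unfolding set_integrable_def
    by (rule integrable_cong_AE_imp) (use ae in auto)
  then have "integrable (distr std_gauss borel T) \<psi>"
    unfolding D by (subst integrable_density) (use nn in auto)
  then show "integrable std_gauss (\<lambda>x. \<psi> (T x))"
    by (subst (asm) integrable_distr_eq) auto
qed

section \<open>The entropy power inequality for a Gaussian summand\<close>

text \<open>Rotation invariance: \<open>(x, z / \<sigma>)\<close> is \<open>(a, b)\<close> rotated,
  so the sum of squares is the same. The extra factor \<open>\<sigma>\<close> standardises the
  density of \<open>z\<close>.\<close>

lemma std_gauss_rotation: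
  fixes x z a b c s \<sigma> :: real
  assumes cs: "c\<^sup>2 + s\<^sup>2 = 1" and \<sigma>: "\<sigma> > 0"
    and x: "x = c * a - s * b" and z: "z = \<sigma> * (s * a + c * b)"
  shows "std_normal_density x * normal_density 0 \<sigma> z * \<sigma> = std_normal_density a * std_normal_density b"
proof -
  have "z / \<sigma> = s * a + c * b" using \<sigma> z by simp
  then have "x\<^sup>2 + (z / \<sigma>)\<^sup>2 = (c\<^sup>2 + s\<^sup>2) * a\<^sup>2 + (c\<^sup>2 + s\<^sup>2) * b\<^sup>2"
    unfolding x by (simp add: power2_eq_square algebra_simps)
  then have e: "x\<^sup>2 + (z / \<sigma>)\<^sup>2 = a\<^sup>2 + b\<^sup>2" using cs by simp
  have "exp (- x\<^sup>2 / 2) * exp (- z\<^sup>2 / (2 * \<sigma>\<^sup>2)) = exp (- (x\<^sup>2 + (z / \<sigma>)\<^sup>2) / 2)"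
    by (simp add: exp_add[symmetric] power_divide field_simps)
  also have "\<dots> = exp (- a\<^sup>2 / 2) * exp (- b\<^sup>2 / 2)"
    by (simp add: e exp_add[symmetric] add_divide_distrib)
  finally show ?thesis
    using \<sigma> by (simp add: normal_density_def real_sqrt_mult)
qed

text \<open>The denominator is the Gaussian density at the rotated coordinate
  \<open>a = c * x + s * z / \<sigma>\<close>. With the other coordinate \<open>b\<close> fixed,
  \<open>T x + z\<close> increases in \<open>a\<close> with derivative
  \<open>c * T' x + s * \<sigma>\<close>, exactly the factor in the integrand. Substitution
  therefore integrates \<open>q\<close> to at most 1, and the Gaussian weight left over in
  \<open>b\<close> has mass 1.\<close>

lemma nn_integral_gauss_rotation_le:
  fixes T T' q :: "real \<Rightarrow> real" and c s \<sigma> :: real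
  assumes T: "\<And>x. (T has_real_derivative T' x) (at x)" and contT': "continuous_on UNIV T'"
    and T'pos: "\<And>x. T' x > 0"
    and q[measurable]: "q \<in> borel_measurable borel" and q_nn: "\<And>y. q y \<ge> 0"
    and q_int: "(\<integral>\<^sup>+y. ennreal (q y) \<partial>lborel) \<le> 1"
    and cs: "c\<^sup>2 + s\<^sup>2 = 1" "c > 0" "s > 0" and \<sigma>: "\<sigma> > 0"
  shows "(\<integral>\<^sup>+x. \<integral>\<^sup>+z. ennreal (std_normal_density x * (normal_density 0 \<sigma> z *
      (q (T x + z) * (c * T' x + s * \<sigma>) / std_normal_density (c * x + s * z / \<sigma>)))) \<partial>lborel \<partial>lborel) \<le> 1"
    (is "(\<integral>\<^sup>+x. \<integral>\<^sup>+z. ennreal (?K x z) \<partial>lborel \<partial>lborel) \<le> 1")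
proof -
  have contT: "continuous_on UNIV T"
    by (auto intro!: continuous_at_imp_continuous_on DERIV_isCont[OF T])
  have [measurable]: "T \<in> borel_measurable borel" "T' \<in> borel_measurable borel"
    using contT contT' by (auto intro: borel_measurable_continuous_onI)
  define J where "J = (\<lambda>a b. ennreal (std_normal_density b) *
    (ennreal (q (T (c * a - s * b) + \<sigma> * (s * a + c * b))) * ennreal (c * T' (c * a - s * b) + s * \<sigma>)))"
  have nnd: "std_normal_density a > 0" for a by (rule normal_density_pos) simp
  \<comment> \<open>The rotation is carried out below as two affine substitutions with Fubini in
    between: \<open>z\<close> to \<open>a\<close> with Jacobian \<open>\<sigma> / s\<close>, then
    \<open>x\<close> to \<open>b\<close> with Jacobian \<open>s\<close>.\<close>
  have K: "ennreal (\<sigma> / s) * ennreal s * ennreal (?K (c * a - s * b) (\<sigma> * (s * a + c * b))) = J a b" for a b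
  proof -
    let ?x = "c * a - s * b" and ?z = "\<sigma> * (s * a + c * b)"
    have arg: "c * ?x + s * ?z / \<sigma> = (c\<^sup>2 + s\<^sup>2) * a"
      using \<sigma> by (simp add: power2_eq_square algebra_simps add_divide_distrib)
    have rot: "std_normal_density ?x * normal_density 0 \<sigma> ?z * \<sigma> = std_normal_density a * std_normal_density b"
      by (rule std_gauss_rotation[OF cs(1) \<sigma> refl refl])
    have "\<sigma> / s * s * ?K ?x ?z = (std_normal_density ?x * normal_density 0 \<sigma> ?z * \<sigma>) *
        (q (T ?x + ?z) * (c * T' ?x + s * \<sigma>)) / std_normal_density a"
      unfolding arg using cs by simp
    also have "\<dots> = std_normal_density b * (q (T ?x + ?z) * (c * T' ?x + s * \<sigma>))"
      unfolding rot using nnd[of a] by simp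
    finally have e: "\<sigma> / s * s * ?K ?x ?z = std_normal_density b * (q (T ?x + ?z) * (c * T' ?x + s * \<sigma>))" .
    have pos: "0 \<le> c * T' ?x + s * \<sigma>" using cs \<sigma> T'pos[of ?x] by simp
    have "ennreal (\<sigma> / s) * ennreal s * ennreal (?K ?x ?z) = ennreal (\<sigma> / s * s * ?K ?x ?z)"
    proof -
      have prod: "ennreal u * ennreal v * ennreal w = ennreal (u * v * w)" if "0 \<le> u" "0 \<le> v" "0 \<le> w" for u v w
        using that by (simp add: ennreal_mult)
      have "0 \<le> ?K ?x ?z" using q_nn pos by (intro mult_nonneg_nonneg divide_nonneg_nonneg) auto
      then show ?thesis using cs \<sigma> by (intro prod) auto
    qed
    also have "\<dots> = J a b"
      unfolding e J_def using q_nn pos by (simp add: ennreal_mult)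
    finally show ?thesis .
  qed
  have inner: "(\<integral>\<^sup>+a. J a b \<partial>lborel) \<le> ennreal (std_normal_density b)" for b
  proof -
    have "(\<integral>\<^sup>+a. ennreal (q (T (c * a - s * b) + \<sigma> * (s * a + c * b))) * ennreal (c * T' (c * a - s * b) + s * \<sigma>) \<partial>lborel)
       = (\<integral>\<^sup>+y. ennreal (q y) * indicator (range (\<lambda>a. T (c * a - s * b) + \<sigma> * (s * a + c * b))) y \<partial>lborel)"
    proof (rule nn_integral_substitution_range[where g="\<lambda>a. T (c * a - s * b) + \<sigma> * (s * a + c * b)"])
      show "((\<lambda>a. T (c * a - s * b) + \<sigma> * (s * a + c * b)) has_real_derivative c * T' (c * a - s * b) + s * \<sigma>) (at a)" for a
        by (rule derivative_eq_intros DERIV_chain2[OF T] | simp)+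
      show "continuous_on UNIV (\<lambda>a. c * T' (c * a - s * b) + s * \<sigma>)"
        by (intro continuous_intros continuous_on_compose2[OF contT']) auto
      show "0 < c * T' (c * a - s * b) + s * \<sigma>" for a
        using cs \<sigma> T'pos by (intro add_pos_pos mult_pos_pos) auto
    qed simp
    also have "\<dots> \<le> (\<integral>\<^sup>+y. ennreal (q y) \<partial>lborel)"
      by (intro nn_integral_mono) (auto simp: indicator_def)
    also have "\<dots> \<le> 1" by (rule q_int)
    finally show ?thesis
      unfolding J_def by (subst nn_integral_cmult) (auto intro: mult_left_le)
  qed
  have "(\<integral>\<^sup>+x. \<integral>\<^sup>+z. ennreal (?K x z) \<partial>lborel \<partial>lborel)
     = (\<integral>\<^sup>+x. ennreal (\<sigma> / s) * (\<integral>\<^sup>+a. ennreal (?K x (- (\<sigma> * c * x / s) + \<sigma> / s * a)) \<partial>lborel) \<partial>lborel)"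
  proof (rule nn_integral_cong)
    fix x
    show "(\<integral>\<^sup>+z. ennreal (?K x z) \<partial>lborel)
      = ennreal (\<sigma> / s) * (\<integral>\<^sup>+a. ennreal (?K x (- (\<sigma> * c * x / s) + \<sigma> / s * a)) \<partial>lborel)"
      using cs \<sigma> nn_integral_real_affine[of "\<lambda>z. ennreal (?K x z)" "\<sigma> / s" "- (\<sigma> * c * x / s)"] by simp
  qed
  also have "\<dots> = (\<integral>\<^sup>+x. \<integral>\<^sup>+a. ennreal (\<sigma> / s) * ennreal (?K x (- (\<sigma> * c * x / s) + \<sigma> / s * a)) \<partial>lborel \<partial>lborel)"
    by (intro nn_integral_cong nn_integral_cmult[symmetric]) measurable
  also have "\<dots> = (\<integral>\<^sup>+a. \<integral>\<^sup>+x. ennreal (\<sigma> / s) * ennreal (?K x (- (\<sigma> * c * x / s) + \<sigma> / s * a)) \<partial>lborel \<partial>lborel)"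
    by (rule lborel_pair.Fubini') measurable
  also have "\<dots> = (\<integral>\<^sup>+a. ennreal s * (\<integral>\<^sup>+b. ennreal (\<sigma> / s) *
      ennreal (?K (c * a + - s * b) (- (\<sigma> * c * (c * a + - s * b) / s) + \<sigma> / s * a)) \<partial>lborel) \<partial>lborel)"
  proof (rule nn_integral_cong)
    fix a
    show "(\<integral>\<^sup>+x. ennreal (\<sigma> / s) * ennreal (?K x (- (\<sigma> * c * x / s) + \<sigma> / s * a)) \<partial>lborel)
      = ennreal s * (\<integral>\<^sup>+b. ennreal (\<sigma> / s) *
      ennreal (?K (c * a + - s * b) (- (\<sigma> * c * (c * a + - s * b) / s) + \<sigma> / s * a)) \<partial>lborel)"
      using cs nn_integral_real_affine[of "\<lambda>x. ennreal (\<sigma> / s) *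
        ennreal (?K x (- (\<sigma> * c * x / s) + \<sigma> / s * a))" "- s" "c * a"] by simp
  qed
  also have "\<dots> = (\<integral>\<^sup>+a. \<integral>\<^sup>+b. J a b \<partial>lborel \<partial>lborel)"
  proof (intro nn_integral_cong)
    fix a
    have z: "- (\<sigma> * c * (c * a + - s * b) / s) + \<sigma> / s * a = \<sigma> * (s * a + c * b)" for b
    proof -
      have "- (\<sigma> * c * (c * a + - s * b) / s) + \<sigma> / s * a = \<sigma> * ((1 - c\<^sup>2) * a / s + c * b)"
        using cs by (simp add: field_simps power2_eq_square)
      also have "(1 - c\<^sup>2) * a / s = s * a"
        using cs(3) unfolding cs(1)[symmetric] by (simp add: power2_eq_square)
      finally show ?thesis .
    qed
    have "ennreal s * (\<integral>\<^sup>+b. ennreal (\<sigma> / s) *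
        ennreal (?K (c * a + - s * b) (- (\<sigma> * c * (c * a + - s * b) / s) + \<sigma> / s * a)) \<partial>lborel)
      = (\<integral>\<^sup>+b. ennreal s * (ennreal (\<sigma> / s) *
        ennreal (?K (c * a + - s * b) (- (\<sigma> * c * (c * a + - s * b) / s) + \<sigma> / s * a))) \<partial>lborel)"
      by (rule nn_integral_cmult[symmetric]) measurable
    also have "\<dots> = (\<integral>\<^sup>+b. J a b \<partial>lborel)"
      unfolding z K[symmetric] by (intro nn_integral_cong) (simp add: mult_ac)
    finally show "ennreal s * (\<integral>\<^sup>+b. ennreal (\<sigma> / s) *
        ennreal (?K (c * a + - s * b) (- (\<sigma> * c * (c * a + - s * b) / s) + \<sigma> / s * a)) \<partial>lborel)
      = (\<integral>\<^sup>+b. J a b \<partial>lborel)" .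
  qed
  also have "\<dots> = (\<integral>\<^sup>+b. \<integral>\<^sup>+a. J a b \<partial>lborel \<partial>lborel)"
    unfolding J_def by (rule lborel_pair.Fubini') measurable
  also have "\<dots> \<le> (\<integral>\<^sup>+b. ennreal (std_normal_density b) \<partial>lborel)"
    by (intro nn_integral_mono inner)
  also have "\<dots> = 1"
    by (subst nn_integral_eq_integral) auto
  finally show ?thesis .
qed

section \<open>The density of the channel output and its logarithm\<close>

abbreviation gauss_noise :: "real \<Rightarrow> real measure" where
  "gauss_noise \<sigma> \<equiv> density lborel (\<lambda>z. ennreal (normal_density 0 \<sigma> z))"

text \<open>The density of \<open>T x + z\<close> for a standard Gaussian \<open>x\<close> and
  independent noise \<open>z\<close>.\<close>

definition out_density :: "real \<Rightarrow> (real \<Rightarrow> real) \<Rightarrow> real \<Rightarrow> real" where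
  "out_density \<sigma> T y = (\<integral>x. normal_density 0 \<sigma> (y - T x) \<partial>std_gauss)"

lemma normal_density_antimono:
  assumes "\<bar>x\<bar> \<le> \<bar>y\<bar>" shows "normal_density 0 \<sigma> y \<le> normal_density 0 \<sigma> x"
proof -
  have "x\<^sup>2 \<le> y\<^sup>2" using assms by (rule abs_le_square_iff[THEN iffD1])
  then show ?thesis
    unfolding normal_density_def by (intro mult_left_mono) (auto intro!: divide_right_mono)
qed

lemma ln_normal_density:
  assumes "\<sigma> > 0"
  shows "ln (normal_density 0 \<sigma> z) = - (ln (2 * pi) / 2) - ln \<sigma> - z\<^sup>2 / (2 * \<sigma>\<^sup>2)"
  using assms by (simp add: normal_density_def ln_mult ln_div ln_sqrt ln_realpow add_divide_distrib)

context
  fixes \<sigma> :: real and T :: "real \<Rightarrow> real"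
  assumes \<sigma>: "\<sigma> > 0" and T_meas[measurable]: "T \<in> borel_measurable borel"
    and T_bounds: "\<And>x. 0 \<le> T x" "\<And>x. T x \<le> 1"
begin

lemma integrable_out_density: "integrable std_gauss (\<lambda>x. normal_density 0 \<sigma> (y - T x))"
proof -
  interpret N: prob_space std_gauss by (rule prob_space_normal_density) simp
  show ?thesis
    by (rule N.integrable_const_bound[where B="normal_density 0 \<sigma> 0"])
       (auto intro!: normal_density_antimono)
qed

lemma out_density_measurable[measurable]: "out_density \<sigma> T \<in> borel_measurable borel"
proof -
  interpret N: prob_space std_gauss by (rule prob_space_normal_density) simp
  show ?thesis unfolding out_density_def[abs_def] by measurable
qed

lemma out_density_lower: "normal_density 0 \<sigma> (\<bar>y\<bar> + 1) \<le> out_density \<sigma> T y"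
proof -
  interpret N: prob_space std_gauss by (rule prob_space_normal_density) simp
  have "(\<integral>x. normal_density 0 \<sigma> (\<bar>y\<bar> + 1) \<partial>std_gauss) \<le> out_density \<sigma> T y"
    unfolding out_density_def
  proof (intro integral_mono integrable_out_density normal_density_antimono)
    show "\<bar>y - T x\<bar> \<le> \<bar>\<bar>y\<bar> + 1\<bar>" for x using T_bounds[of x] by linarith
  qed auto
  then show ?thesis by (simp add: N.prob_space[simplified])
qed

lemma out_density_upper: "out_density \<sigma> T y \<le> normal_density 0 \<sigma> 0"
proof -
  interpret N: prob_space std_gauss by (rule prob_space_normal_density) simp
  have "out_density \<sigma> T y \<le> (\<integral>x. normal_density 0 \<sigma> 0 \<partial>std_gauss)"
    unfolding out_density_def
    by (intro integral_mono integrable_out_density normal_density_antimono) auto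
  then show ?thesis by (simp add: N.prob_space[simplified])
qed

lemma out_density_pos: "out_density \<sigma> T y > 0"
  using out_density_lower[of y] normal_density_pos[OF \<sigma>] by (rule less_le_trans[rotated])

lemma nn_integral_out_density: "(\<integral>\<^sup>+y. ennreal (out_density \<sigma> T y) \<partial>lborel) = 1"
proof -
  interpret N: prob_space std_gauss by (rule prob_space_normal_density) simp
  interpret P: pair_sigma_finite std_gauss lborel ..
  have "(\<integral>\<^sup>+y. ennreal (out_density \<sigma> T y) \<partial>lborel)
      = (\<integral>\<^sup>+y. \<integral>\<^sup>+x. ennreal (normal_density 0 \<sigma> (y - T x)) \<partial>std_gauss \<partial>lborel)"
    unfolding out_density_def
    by (intro nn_integral_cong nn_integral_eq_integral[symmetric] integrable_out_density) auto
  also have "\<dots> = (\<integral>\<^sup>+x. \<integral>\<^sup>+y. ennreal (normal_density 0 \<sigma> (y - T x)) \<partial>lborel \<partial>std_gauss)"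
    by (rule P.Fubini') measurable
  also have "\<dots> = (\<integral>\<^sup>+x. 1 \<partial>std_gauss)"
  proof (rule nn_integral_cong)
    fix x
    have "(\<integral>\<^sup>+y. ennreal (normal_density 0 \<sigma> (y - T x)) \<partial>lborel)
        = (\<integral>\<^sup>+y. ennreal (normal_density (T x) \<sigma> y) \<partial>lborel)"
      by (simp add: normal_density_def)
    also have "\<dots> = 1" by (subst nn_integral_eq_integral) (use \<sigma> in auto)
    finally show "(\<integral>\<^sup>+y. ennreal (normal_density 0 \<sigma> (y - T x)) \<partial>lborel) = 1" .
  qed
  also have "\<dots> = 1" by (simp add: N.emeasure_space_1[simplified])
  finally show ?thesis .
qed

text \<open>The signal stays in the unit interval, so the output density at \<open>y\<close> lies
  between the noise densities at \<open>\<bar>y\<bar> + 1\<close> and at 0. The resulting envelope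
  depends on the noise alone and has finite mean, which makes the entropy integral genuine and not a
  default value.\<close>

lemma ln_out_density_bound:
  "\<bar>ln (out_density \<sigma> T (T x + z))\<bar> \<le> \<bar>ln (2 * pi) / 2\<bar> + \<bar>ln \<sigma>\<bar> + 4 / \<sigma>\<^sup>2 + z\<^sup>2 / \<sigma>\<^sup>2"
proof -
  let ?y = "T x + z"
  have up: "ln (out_density \<sigma> T ?y) \<le> ln (normal_density 0 \<sigma> 0)"
    using out_density_upper out_density_pos by (intro ln_mono) auto
  have lo: "ln (normal_density 0 \<sigma> (\<bar>?y\<bar> + 1)) \<le> ln (out_density \<sigma> T ?y)"
    using out_density_lower normal_density_pos[OF \<sigma>] by (intro ln_mono) auto
  have "(\<bar>?y\<bar> + 1)\<^sup>2 \<le> (\<bar>z\<bar> + 2)\<^sup>2"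
    using T_bounds[of x] by (intro power_mono) auto
  also have "\<dots> \<le> 2 * z\<^sup>2 + 8"
    using zero_le_power2[of "\<bar>z\<bar> - 2"] by (simp add: power2_eq_square algebra_simps)
  finally have "(\<bar>?y\<bar> + 1)\<^sup>2 / (2 * \<sigma>\<^sup>2) \<le> (2 * z\<^sup>2 + 8) / (2 * \<sigma>\<^sup>2)"
    by (rule divide_right_mono) simp
  also have "\<dots> = 4 / \<sigma>\<^sup>2 + z\<^sup>2 / \<sigma>\<^sup>2" using \<sigma> by (simp add: field_simps)
  finally have "(\<bar>?y\<bar> + 1)\<^sup>2 / (2 * \<sigma>\<^sup>2) \<le> 4 / \<sigma>\<^sup>2 + z\<^sup>2 / \<sigma>\<^sup>2" .
  moreover have "0 \<le> 4 / \<sigma>\<^sup>2" "0 \<le> z\<^sup>2 / \<sigma>\<^sup>2" by auto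
  ultimately show ?thesis
    using up lo unfolding ln_normal_density[OF \<sigma>] by simp
qed

end

lemma gauss_noise_moments:
  assumes "\<sigma> > 0"
  shows "integrable (gauss_noise \<sigma>) (\<lambda>z. z)" "(\<integral>z. z \<partial>gauss_noise \<sigma>) = 0"
    "integrable (gauss_noise \<sigma>) (\<lambda>z. z\<^sup>2)" "(\<integral>z. z\<^sup>2 \<partial>gauss_noise \<sigma>) = \<sigma>\<^sup>2"
proof -
  show "integrable (gauss_noise \<sigma>) (\<lambda>z. z)"
    using integrable_normal_moment_nz_1[OF assms, of 0] by (subst integrable_density) auto
  show "(\<integral>z. z \<partial>gauss_noise \<sigma>) = 0"
    using integral_normal_moment_nz_1[OF assms, of 0] by (subst integral_density) auto
  show "integrable (gauss_noise \<sigma>) (\<lambda>z. z\<^sup>2)"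
    using integrable_normal_moment[OF assms, of 0 2] by (subst integrable_density) auto
  show "(\<integral>z. z\<^sup>2 \<partial>gauss_noise \<sigma>) = \<sigma>\<^sup>2"
    using integral_normal_moment_even[OF assms, of 0 1] assms
    by (subst integral_density) (auto simp: fact_numeral)
qed

lemma (in pair_prob_space) integral_fst_snd:
  fixes f g :: "_ \<Rightarrow> real"
  shows "integrable M1 f \<Longrightarrow> integrable (M1 \<Otimes>\<^sub>M M2) (\<lambda>p. f (fst p))"
    and "integrable M1 f \<Longrightarrow> (\<integral>p. f (fst p) \<partial>(M1 \<Otimes>\<^sub>M M2)) = (\<integral>x. f x \<partial>M1)"
    and "integrable M2 g \<Longrightarrow> integrable (M1 \<Otimes>\<^sub>M M2) (\<lambda>p. g (snd p))"
    and "integrable M2 g \<Longrightarrow> (\<integral>p. g (snd p) \<partial>(M1 \<Otimes>\<^sub>M M2)) = (\<integral>x. g x \<partial>M2)"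
proof -
  have d1: "distr (M1 \<Otimes>\<^sub>M M2) M1 fst = M1" by (rule M2.distr_pair_fst)
  have d2: "distr (M1 \<Otimes>\<^sub>M M2) M2 snd = M2"
    by (subst distr_pair_swap) (simp add: distr_distr comp_def case_prod_beta M1.distr_pair_fst)
  { assume f: "integrable M1 f"
    then show "integrable (M1 \<Otimes>\<^sub>M M2) (\<lambda>p. f (fst p))"
      using integrable_distr[of fst "M1 \<Otimes>\<^sub>M M2" M1 f] d1 by simp
    show "(\<integral>p. f (fst p) \<partial>(M1 \<Otimes>\<^sub>M M2)) = (\<integral>x. f x \<partial>M1)"
      using integral_distr[of fst "M1 \<Otimes>\<^sub>M M2" M1 f] d1 f by simp }
  { assume g: "integrable M2 g"
    then show "integrable (M1 \<Otimes>\<^sub>M M2) (\<lambda>p. g (snd p))"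
      using integrable_distr[of snd "M1 \<Otimes>\<^sub>M M2" M2 g] d2 by simp
    show "(\<integral>p. g (snd p) \<partial>(M1 \<Otimes>\<^sub>M M2)) = (\<integral>x. g x \<partial>M2)"
      using integral_distr[of snd "M1 \<Otimes>\<^sub>M M2" M2 g] d2 g by simp }
qed

text \<open>Concavity of \<open>ln\<close> with weights \<open>c\<^sup>2\<close> and
  \<open>s\<^sup>2\<close>, since
  \<open>c * u + s * v = c\<^sup>2 * (u / c) + s\<^sup>2 * (v / s)\<close>.\<close>

lemma ln_weighted_mean_ge:
  fixes c s u v :: real
  assumes cs: "c\<^sup>2 + s\<^sup>2 = 1" "c > 0" "s > 0" and "u > 0" "v > 0"
  shows "c\<^sup>2 * (ln u - ln c) + s\<^sup>2 * (ln v - ln s) \<le> ln (c * u + s * v)"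
proof -
  define m where "m = c * u + s * v"
  have m: "m > 0" unfolding m_def using assms by (simp add: add_pos_pos)
  have u: "c\<^sup>2 * (ln u - ln c - ln m) \<le> c\<^sup>2 * (u / (c * m) - 1)"
    using assms m ln_le_minus_one[of "u / (c * m)"] by (intro mult_left_mono) (auto simp: ln_div ln_mult)
  have v: "s\<^sup>2 * (ln v - ln s - ln m) \<le> s\<^sup>2 * (v / (s * m) - 1)"
    using assms m ln_le_minus_one[of "v / (s * m)"] by (intro mult_left_mono) (auto simp: ln_div ln_mult)
  have "c\<^sup>2 * (u / (c * m)) + s\<^sup>2 * (v / (s * m)) = (c * u + s * v) / m"
    using assms m by (simp add: power2_eq_square add_divide_distrib)
  also have "\<dots> = 1" using m by (simp add: m_def)
  finally have "c\<^sup>2 * (u / (c * m) - 1) + s\<^sup>2 * (v / (s * m) - 1) = 0"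
    using cs(1) by (simp add: right_diff_distrib)
  with u v have "c\<^sup>2 * (ln u - ln c) + s\<^sup>2 * (ln v - ln s) \<le> (c\<^sup>2 + s\<^sup>2) * ln m"
    by (simp add: algebra_simps)
  then show ?thesis using cs(1) by (simp add: m_def)
qed

text \<open>
  \<open>ln (\<tau>\<^sup>2)\<close> is twice the differential entropy of the transported law, minus \<open>ln (2 \<pi> e)\<close>. The
  proof is Rioul's: rotate the two Gaussians by the angle with cosine \<open>c\<close>, compare the output density with the
  density of \<open>T x + z\<close> conditional on the second rotated coordinate, and use concavity of \<open>ln\<close>.
\<close>

lemma gauss_entropy_power:
  fixes T T' :: "real \<Rightarrow> real" and \<sigma> \<tau> :: real
  assumes \<sigma>: "\<sigma> > 0"
    and T: "\<And>x. (T has_real_derivative T' x) (at x)" and contT': "continuous_on UNIV T'"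
    and T'pos: "\<And>x. T' x > 0" and T_bounds: "\<And>x. 0 \<le> T x" "\<And>x. T x \<le> 1"
    and lnT': "integrable std_gauss (\<lambda>x. ln (T' x))"
    and \<tau>: "\<tau> = exp (\<integral>x. ln (T' x) \<partial>std_gauss)"
  defines "M \<equiv> std_gauss \<Otimes>\<^sub>M gauss_noise \<sigma>"
  shows "integrable M (\<lambda>p. ln (out_density \<sigma> T (T (fst p) + snd p)))"
    and "(\<integral>p. ln (out_density \<sigma> T (T (fst p) + snd p)) \<partial>M)
      \<le> - (ln (2 * pi) / 2) - 1 / 2 - ln (\<tau>\<^sup>2 + \<sigma>\<^sup>2) / 2"
proof -
  interpret N1: prob_space std_gauss by (rule prob_space_normal_density) simp
  interpret N2: prob_space "gauss_noise \<sigma>" by (rule prob_space_normal_density) (rule \<sigma>)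
  interpret P: pair_prob_space std_gauss "gauss_noise \<sigma>" ..
  note mom1 = gauss_noise_moments[OF zero_less_one] and mom2 = gauss_noise_moments[OF \<sigma>]
  have contT: "continuous_on UNIV T"
    by (auto intro!: continuous_at_imp_continuous_on DERIV_isCont[OF T])
  have [measurable]: "T \<in> borel_measurable borel" "T' \<in> borel_measurable borel"
    using contT contT' by (auto intro: borel_measurable_continuous_onI)
  note [measurable] = out_density_measurable[OF \<sigma> _ T_bounds]
  define q where "q = out_density \<sigma> T"
  have q_meas[measurable]: "q \<in> borel_measurable borel" unfolding q_def by simp
  have qpos: "q y > 0" for y unfolding q_def by (rule out_density_pos) (use \<sigma> T_bounds in auto)
  have q_int: "(\<integral>\<^sup>+y. ennreal (q y) \<partial>lborel) = 1"
    unfolding q_def by (rule nn_integral_out_density) (use \<sigma> T_bounds in auto)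
  have nnd: "std_normal_density a > 0" for a by (rule normal_density_pos) simp
  have nnd_ne: "std_normal_density a \<noteq> 0" for a using nnd[of a] by simp
  have qpos_ne: "q y \<noteq> 0" for y using qpos[of y] by simp
  define K where "K = \<bar>ln (2 * pi) / 2\<bar> + \<bar>ln \<sigma>\<bar> + 4 / \<sigma>\<^sup>2"
  have q_bd: "\<bar>ln (q (T x + z))\<bar> \<le> K + z\<^sup>2 / \<sigma>\<^sup>2" for x z
    unfolding q_def K_def by (rule ln_out_density_bound) (use \<sigma> T_bounds in auto)
  have int_z2: "integrable M (\<lambda>p. (snd p)\<^sup>2)"
    unfolding M_def by (rule P.integral_fst_snd(3)[OF mom2(3)])
  show int_q: "integrable M (\<lambda>p. ln (out_density \<sigma> T (T (fst p) + snd p)))"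
  proof (rule Bochner_Integration.integrable_bound)
    show "integrable M (\<lambda>p. K + (snd p)\<^sup>2 / \<sigma>\<^sup>2)"
      using int_z2 by (auto simp: M_def)
    show "(\<lambda>p. ln (out_density \<sigma> T (T (fst p) + snd p))) \<in> borel_measurable M"
      unfolding M_def q_def[symmetric] by measurable
    show "AE p in M. norm (ln (out_density \<sigma> T (T (fst p) + snd p))) \<le> norm (K + (snd p)\<^sup>2 / \<sigma>\<^sup>2)"
    proof (rule AE_I2)
      fix p show "norm (ln (out_density \<sigma> T (T (fst p) + snd p))) \<le> norm (K + (snd p)\<^sup>2 / \<sigma>\<^sup>2)"
        using q_bd[of "fst p" "snd p"] by (simp add: q_def)
    qed
  qed
  \<comment> \<open>The angle is chosen so that \<open>\<tau> / c = \<sigma> / s = r\<close>. The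
    two terms of the concavity bound then combine to \<open>ln r\<close>, which is half the
    logarithm of the sum of the entropy powers.\<close>
  define r where "r = sqrt (\<tau>\<^sup>2 + \<sigma>\<^sup>2)"
  define c where "c = \<tau> / r"
  define s where "s = \<sigma> / r"
  have \<tau>pos: "\<tau> > 0" using \<tau> by simp
  have sum_pos: "\<tau>\<^sup>2 + \<sigma>\<^sup>2 > 0" using \<sigma> by (simp add: add_nonneg_pos)
  have r: "r > 0" "r\<^sup>2 = \<tau>\<^sup>2 + \<sigma>\<^sup>2" unfolding r_def using sum_pos by auto
  have cs: "c\<^sup>2 + s\<^sup>2 = 1" "c > 0" "s > 0"
    using r \<tau>pos \<sigma> sum_pos by (auto simp: c_def s_def power_divide add_divide_distrib[symmetric])
  have lnr: "ln \<tau> - ln c = ln r" "ln \<sigma> - ln s = ln r"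
    using r \<tau>pos \<sigma> by (auto simp: c_def s_def ln_div)
  \<comment> \<open>The quotient of the output density and the conditional density of the output
    given the second rotated coordinate. Its mean is at most 1, so \<open>ln R \<le> R - 1\<close>
    is Gibbs' inequality.\<close>
  define R where "R = (\<lambda>p. q (T (fst p) + snd p) * (c * T' (fst p) + s * \<sigma>) / std_normal_density (c * fst p + s * snd p / \<sigma>))"
  define A where "A = (\<lambda>p::real \<times> real. (c * fst p + s * snd p / \<sigma>)\<^sup>2 / 2)"
  \<comment> \<open>A lower bound for \<open>ln R\<close> in which concavity has split up the
    logarithm of \<open>c * T' (fst p) + s * \<sigma>\<close>. Each summand is integrable, so the
    mean can be taken term by term.\<close>
  define L where "L = (\<lambda>p. ln (q (T (fst p) + snd p)) + c\<^sup>2 * (ln (T' (fst p)) - ln c)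
      + s\<^sup>2 * (ln \<sigma> - ln s) + ln (2 * pi) / 2 + A p)"
  have Rpos: "R p > 0" for p
    unfolding R_def using qpos nnd T'pos cs \<sigma> by (intro divide_pos_pos mult_pos_pos add_pos_pos) auto
  have L_le: "L p \<le> R p - 1" for p
  proof -
    have d: "c * T' (fst p) + s * \<sigma> > 0" using T'pos cs \<sigma> by (intro add_pos_pos mult_pos_pos) auto
    have "ln (R p) = ln (q (T (fst p) + snd p)) + ln (c * T' (fst p) + s * \<sigma>) + ln (2 * pi) / 2 + A p"
      unfolding R_def A_def using qpos nnd d by (simp add: ln_div ln_mult nnd_ne qpos_ne ln_normal_density)
    then have "L p \<le> ln (R p)"
      using ln_weighted_mean_ge[OF cs T'pos \<sigma>, of "fst p"] by (simp add: L_def)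
    also have "\<dots> \<le> R p - 1" using Rpos by (rule ln_le_minus_one)
    finally show ?thesis .
  qed
  have R_meas[measurable]: "R \<in> borel_measurable M"
    unfolding R_def M_def by measurable
  have nnR: "(\<integral>\<^sup>+p. ennreal (R p) \<partial>M) \<le> 1"
  proof -
    have "(\<integral>\<^sup>+p. ennreal (R p) \<partial>M) = (\<integral>\<^sup>+x. \<integral>\<^sup>+z. ennreal (R (x, z)) \<partial>gauss_noise \<sigma> \<partial>std_gauss)"
      using R_meas unfolding M_def by (subst N2.nn_integral_fst) auto
    also have "\<dots> = (\<integral>\<^sup>+x. ennreal (std_normal_density x) *
        (\<integral>\<^sup>+z. ennreal (normal_density 0 \<sigma> z) * ennreal (R (x, z)) \<partial>lborel) \<partial>lborel)"
      unfolding R_def by (simp add: nn_integral_density)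
    also have "\<dots> = (\<integral>\<^sup>+x. \<integral>\<^sup>+z. ennreal (std_normal_density x * (normal_density 0 \<sigma> z * R (x, z))) \<partial>lborel \<partial>lborel)"
    proof (rule nn_integral_cong)
      fix x
      have "(\<integral>\<^sup>+z. ennreal (std_normal_density x * (normal_density 0 \<sigma> z * R (x, z))) \<partial>lborel)
        = (\<integral>\<^sup>+z. ennreal (std_normal_density x) * (ennreal (normal_density 0 \<sigma> z) * ennreal (R (x, z))) \<partial>lborel)"
        using Rpos by (intro nn_integral_cong) (simp add: ennreal_mult less_imp_le)
      also have "\<dots> = ennreal (std_normal_density x) *
        (\<integral>\<^sup>+z. ennreal (normal_density 0 \<sigma> z) * ennreal (R (x, z)) \<partial>lborel)"
        unfolding R_def fst_conv snd_conv by (rule nn_integral_cmult) measurable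
      finally show "ennreal (std_normal_density x) *
        (\<integral>\<^sup>+z. ennreal (normal_density 0 \<sigma> z) * ennreal (R (x, z)) \<partial>lborel)
        = (\<integral>\<^sup>+z. ennreal (std_normal_density x * (normal_density 0 \<sigma> z * R (x, z))) \<partial>lborel)" by simp
    qed
    also have "\<dots> \<le> 1"
      unfolding R_def fst_conv snd_conv
      by (rule nn_integral_gauss_rotation_le[OF T contT' T'pos q_meas _ _ cs \<sigma>])
         (use qpos q_int in \<open>auto intro: less_imp_le\<close>)
    finally show ?thesis .
  qed
  have intR: "integrable M R"
    using nnR Rpos by (intro integrableI_bounded) (auto simp: less_imp_le intro: le_less_trans)
  have ER: "(\<integral>p. R p \<partial>M) \<le> 1"
    using nnR Rpos by (subst integral_eq_nn_integral) (auto simp: less_imp_le enn2real_leI)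
  have Mprob: "prob_space M" unfolding M_def by (rule P.prob_space_axioms)
  then interpret M: prob_space M .
  have int_x2: "integrable M (\<lambda>p. (fst p)\<^sup>2)" "(\<integral>p. (fst p)\<^sup>2 \<partial>M) = 1"
    unfolding M_def using P.integral_fst_snd(1,2)[OF mom1(3)] mom1(4) by simp_all
  have Ez2: "(\<integral>p. (snd p)\<^sup>2 \<partial>M) = \<sigma>\<^sup>2"
    unfolding M_def using P.integral_fst_snd(4)[OF mom2(3)] mom2(4) by simp
  have int_xz: "integrable M (\<lambda>p. fst p * snd p)"
  proof (rule Bochner_Integration.integrable_bound)
    show "integrable M (\<lambda>p. (fst p)\<^sup>2 + (snd p)\<^sup>2)" using int_x2 int_z2 by auto
    show "AE p in M. norm (fst p * snd p) \<le> norm ((fst p)\<^sup>2 + (snd p)\<^sup>2)"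
    proof (rule AE_I2)
      fix p :: "real \<times> real"
      have "2 * \<bar>fst p * snd p\<bar> \<le> (fst p)\<^sup>2 + (snd p)\<^sup>2"
        using sum_squares_bound[of "\<bar>fst p\<bar>" "\<bar>snd p\<bar>"] by (simp add: abs_mult)
      then show "norm (fst p * snd p) \<le> norm ((fst p)\<^sup>2 + (snd p)\<^sup>2)" by simp
    qed
  qed (simp add: M_def)
  have Exz: "(\<integral>p. fst p * snd p \<partial>M) = 0"
    using P.integral_fst'[of "\<lambda>p. fst p * snd p"] int_xz mom2(2) unfolding M_def by simp
  have A_eq: "A = (\<lambda>p. c\<^sup>2 / 2 * (fst p)\<^sup>2 + c * s / \<sigma> * (fst p * snd p) + s\<^sup>2 / (2 * \<sigma>\<^sup>2) * (snd p)\<^sup>2)"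
    unfolding A_def using \<sigma> by (simp add: fun_eq_iff field_simps power2_eq_square)
  have intA: "integrable M A" unfolding A_eq using int_x2 int_xz int_z2 by simp
  \<comment> \<open>\<open>c * x + s * z / \<sigma>\<close> has second moment
    \<open>c\<^sup>2 + s\<^sup>2 = 1\<close>; the cross term vanishes by independence.\<close>
  have EA: "(\<integral>p. A p \<partial>M) = 1 / 2"
  proof -
    have "(\<integral>p. A p \<partial>M) = c\<^sup>2 / 2 + s\<^sup>2 / 2"
      unfolding A_eq using int_x2 int_xz int_z2 Exz Ez2 \<sigma> by simp
    then show ?thesis using cs(1) by (simp add: add_divide_distrib[symmetric])
  qed
  have lnT'M: "integrable M (\<lambda>p. ln (T' (fst p)))" "(\<integral>p. ln (T' (fst p)) \<partial>M) = ln \<tau>"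
    unfolding M_def using P.integral_fst_snd(1,2)[OF lnT'] \<tau> by simp_all
  have int_q': "integrable M (\<lambda>p. ln (q (T (fst p) + snd p)))" using int_q by (simp add: q_def)
  have intL: "integrable M L" unfolding L_def using int_q' lnT'M intA by simp
  have "(\<integral>p. L p \<partial>M) = (\<integral>p. ln (q (T (fst p) + snd p)) \<partial>M) + c\<^sup>2 * (ln \<tau> - ln c)
      + s\<^sup>2 * (ln \<sigma> - ln s) + ln (2 * pi) / 2 + 1 / 2"
    unfolding L_def using int_q' lnT'M intA EA by (simp add: M.prob_space)
  moreover have "c\<^sup>2 * (ln \<tau> - ln c) + s\<^sup>2 * (ln \<sigma> - ln s) = (c\<^sup>2 + s\<^sup>2) * ln r"
    unfolding lnr by (simp add: algebra_simps)
  moreover have "(c\<^sup>2 + s\<^sup>2) * ln r = ln (\<tau>\<^sup>2 + \<sigma>\<^sup>2) / 2"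
    using cs sum_pos by (simp add: r_def ln_sqrt)
  ultimately have EL: "(\<integral>p. L p \<partial>M) = (\<integral>p. ln (q (T (fst p) + snd p)) \<partial>M)
      + ln (\<tau>\<^sup>2 + \<sigma>\<^sup>2) / 2 + ln (2 * pi) / 2 + 1 / 2" by simp
  have "(\<integral>p. L p \<partial>M) \<le> (\<integral>p. R p - 1 \<partial>M)"
    using intL intR L_le by (intro integral_mono) auto
  also have "\<dots> \<le> 0" using intR ER by (simp add: M.prob_space)
  finally show "(\<integral>p. ln (out_density \<sigma> T (T (fst p) + snd p)) \<partial>M)
      \<le> - (ln (2 * pi) / 2) - 1 / 2 - ln (\<tau>\<^sup>2 + \<sigma>\<^sup>2) / 2"
    unfolding EL by (simp add: q_def)
qed

section \<open>The information of the channel\<close>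

text \<open>The input vector is driven by one Gaussian and in general has no Lebesgue density. Its
  own law \<open>P\<close> serves as reference measure: relative to it the input has density 1, and
  the pair has the noise density at output minus signal. The mean log quotient is then pulled back
  to the Gaussian space.\<close>

lemma channel_information_gauss_input:
  fixes \<xi> :: "real \<Rightarrow> nat \<Rightarrow> real" and h :: "nat \<Rightarrow> real" and n :: nat and \<sigma> :: real
  assumes \<sigma>: "\<sigma> > 0" and \<xi>: "\<xi> \<in> borel \<rightarrow>\<^sub>M (\<Pi>\<^sub>M k\<in>{1..n}. (borel :: real measure))"
  defines "S \<equiv> \<lambda>x. \<Sum>k=1..n. h k * \<xi> x k"
  assumes S: "\<And>x. 0 \<le> S x" "\<And>x. S x \<le> 1"
  shows "channel_information n h \<sigma> (distr std_gauss (\<Pi>\<^sub>M k\<in>{1..n}. borel) \<xi>)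
    = (\<integral>p. ln (normal_density 0 \<sigma> (snd p)) - ln (out_density \<sigma> S (S (fst p) + snd p))
        \<partial>(std_gauss \<Otimes>\<^sub>M gauss_noise \<sigma>))"
proof -
  define B where "B = (\<Pi>\<^sub>M k\<in>{1..n}. (borel :: real measure))"
  define P where "P = distr std_gauss B \<xi>"
  have \<xi>'[measurable]: "\<xi> \<in> std_gauss \<rightarrow>\<^sub>M B"
    unfolding measurable_density_eq1 measurable_lborel2 B_def by (rule \<xi>)
  have sP[measurable_cong]: "sets P = sets B" by (simp add: P_def)
  interpret N1: prob_space std_gauss by (rule prob_space_normal_density) simp
  interpret N2: prob_space "gauss_noise \<sigma>" by (rule prob_space_normal_density) (rule \<sigma>)
  interpret P: prob_space P unfolding P_def by (rule N1.prob_space_distr[OF \<xi>'])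
  interpret PP: pair_prob_space P "gauss_noise \<sigma>" ..
  define C where "C = channel_space \<sigma> P"
  have C_eq: "C = P \<Otimes>\<^sub>M gauss_noise \<sigma>" by (simp add: C_def channel_space_def)
  have sC[measurable_cong]: "sets C = sets (B \<Otimes>\<^sub>M borel)"
    unfolding C_eq by (rule sets_pair_measure_cong) (simp_all add: sP)
  interpret C: prob_space C unfolding C_eq by (rule PP.prob_space_axioms)
  interpret C: information_space C "exp 1" by standard simp
  define s where "s = (\<lambda>x :: nat \<Rightarrow> real. \<Sum>k=1..n. h k * x k)"
  have s_meas[measurable]: "s \<in> B \<rightarrow>\<^sub>M borel"
    unfolding s_def B_def by measurable
  have S_eq: "S x = s (\<xi> x)" for x by (simp add: S_def s_def)
  have S_meas[measurable]: "S \<in> borel_measurable borel"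
    unfolding S_eq[abs_def] using measurable_compose[OF \<xi>' s_meas] by simp
  have Y_eq: "channel_output n h = (\<lambda>p. s (fst p) + snd p)"
    by (simp add: channel_output_def s_def fun_eq_iff split_beta)
  define q where "q = out_density \<sigma> S"
  have q_meas[measurable]: "q \<in> borel_measurable borel"
    unfolding q_def by (rule out_density_measurable) (use \<sigma> S in auto)
  have qpos: "q y > 0" for y unfolding q_def by (rule out_density_pos) (use \<sigma> S in auto)
  have shift: "(\<integral>\<^sup>+z. f (t + z) \<partial>gauss_noise \<sigma>) = (\<integral>\<^sup>+y. ennreal (normal_density 0 \<sigma> (y - t)) * f y \<partial>lborel)"
    if [measurable]: "f \<in> borel_measurable borel" for f :: "real \<Rightarrow> ennreal" and t
  proof -
    have "(\<integral>\<^sup>+y. ennreal (normal_density 0 \<sigma> (y - t)) * f y \<partial>lborel)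
       = (\<integral>\<^sup>+z. ennreal (normal_density 0 \<sigma> z) * f (t + z) \<partial>lborel)"
      using nn_integral_real_affine[of "\<lambda>y. ennreal (normal_density 0 \<sigma> (y - t)) * f y" 1 t] by simp
    then show ?thesis by (simp add: nn_integral_density)
  qed
  have q_nn: "(\<integral>\<^sup>+x. ennreal (normal_density 0 \<sigma> (y - s x)) \<partial>P) = ennreal (q y)" for y
  proof -
    have "(\<integral>\<^sup>+x. ennreal (normal_density 0 \<sigma> (y - s x)) \<partial>P)
       = (\<integral>\<^sup>+x. ennreal (normal_density 0 \<sigma> (y - S x)) \<partial>std_gauss)"
      unfolding P_def S_eq by (subst nn_integral_distr) auto
    also have "\<dots> = ennreal (q y)"
      unfolding q_def out_density_def
      by (intro nn_integral_eq_integral integrable_out_density) (use \<sigma> S in auto)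
    finally show ?thesis .
  qed
  have dX: "distributed C P fst (\<lambda>x. ennreal 1)"
    unfolding distributed_def
  proof (intro conjI)
    have "distr C P fst = P" unfolding C_eq by (rule N2.distr_pair_fst)
    then show "distr C P fst = density P (\<lambda>x. ennreal 1)" by (simp add: density_1)
  qed (auto simp: C_eq)
  have joint: "(\<integral>\<^sup>+p. f (fst p, s (fst p) + snd p) \<partial>C)
      = (\<integral>\<^sup>+x. \<integral>\<^sup>+y. ennreal (normal_density 0 \<sigma> (y - s x)) * f (x, y) \<partial>lborel \<partial>P)"
    if [measurable]: "f \<in> borel_measurable (B \<Otimes>\<^sub>M borel)" for f
  proof -
    have "(\<integral>\<^sup>+p. f (fst p, s (fst p) + snd p) \<partial>C) = (\<integral>\<^sup>+x. \<integral>\<^sup>+z. f (x, s x + z) \<partial>gauss_noise \<sigma> \<partial>P)"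
      unfolding C_eq by (subst N2.nn_integral_fst[symmetric]) auto
    also have "\<dots> = (\<integral>\<^sup>+x. \<integral>\<^sup>+y. ennreal (normal_density 0 \<sigma> (y - s x)) * f (x, y) \<partial>lborel \<partial>P)"
    proof (rule nn_integral_cong)
      fix x assume "x \<in> space P"
      then have x[measurable]: "x \<in> space B" using sets_eq_imp_space_eq[OF sP] by simp
      show "(\<integral>\<^sup>+z. f (x, s x + z) \<partial>gauss_noise \<sigma>) = (\<integral>\<^sup>+y. ennreal (normal_density 0 \<sigma> (y - s x)) * f (x, y) \<partial>lborel)"
        by (rule shift[of "\<lambda>y. f (x, y)"]) measurable
    qed
    finally show ?thesis .
  qed
  have dXY: "distributed C (P \<Otimes>\<^sub>M lborel) (\<lambda>p. (fst p, channel_output n h p))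
      (\<lambda>p. ennreal (normal_density 0 \<sigma> (snd p - s (fst p))))"
    unfolding distributed_def
  proof (intro conjI measure_eqI)
    fix A assume "A \<in> sets (distr C (P \<Otimes>\<^sub>M lborel) (\<lambda>p. (fst p, channel_output n h p)))"
    then have A[measurable]: "A \<in> sets (P \<Otimes>\<^sub>M lborel)" by simp
    have sPl: "sets (P \<Otimes>\<^sub>M lborel) = sets (B \<Otimes>\<^sub>M borel)"
      by (rule sets_pair_measure_cong) (simp_all add: sP)
    have A'[measurable]: "A \<in> sets (B \<Otimes>\<^sub>M borel)" using A unfolding sPl .
    have "emeasure (distr C (P \<Otimes>\<^sub>M lborel) (\<lambda>p. (fst p, channel_output n h p))) A
      = (\<integral>\<^sup>+p. indicator A p \<partial>distr C (P \<Otimes>\<^sub>M lborel) (\<lambda>p. (fst p, channel_output n h p)))"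
      by simp
    also have "\<dots> = (\<integral>\<^sup>+p. indicator A (fst p, s (fst p) + snd p) \<partial>C)"
      unfolding Y_eq by (subst nn_integral_distr) (auto simp: C_eq)
    also have "\<dots> = (\<integral>\<^sup>+x. \<integral>\<^sup>+y. ennreal (normal_density 0 \<sigma> (y - s x)) * indicator A (x, y) \<partial>lborel \<partial>P)"
      by (rule joint) measurable
    also have "\<dots> = (\<integral>\<^sup>+p. ennreal (normal_density 0 \<sigma> (snd p - s (fst p))) * indicator A p \<partial>(P \<Otimes>\<^sub>M lborel))"
      by (subst lborel.nn_integral_fst[symmetric]) auto
    also have "\<dots> = emeasure (density (P \<Otimes>\<^sub>M lborel) (\<lambda>p. ennreal (normal_density 0 \<sigma> (snd p - s (fst p))))) A"
      by (subst emeasure_density) auto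
    finally show "emeasure (distr C (P \<Otimes>\<^sub>M lborel) (\<lambda>p. (fst p, channel_output n h p))) A = \<dots>" .
  qed (auto simp: C_eq Y_eq)
  have dY: "distributed C lborel (channel_output n h) (\<lambda>y. ennreal (q y))"
    unfolding distributed_def
  proof (intro conjI measure_eqI)
    fix A assume "A \<in> sets (distr C lborel (channel_output n h))"
    then have A[measurable]: "A \<in> sets borel" by simp
    interpret PL: pair_sigma_finite P lborel ..
    have "emeasure (distr C lborel (channel_output n h)) A
      = (\<integral>\<^sup>+y. indicator A y \<partial>distr C lborel (channel_output n h))"
      by simp
    also have "\<dots> = (\<integral>\<^sup>+p. (\<lambda>(x, y). indicator A y) (fst p, s (fst p) + snd p) \<partial>C)"
      unfolding Y_eq by (subst nn_integral_distr) (auto simp: C_eq)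
    also have "\<dots> = (\<integral>\<^sup>+x. \<integral>\<^sup>+y. ennreal (normal_density 0 \<sigma> (y - s x)) * indicator A y \<partial>lborel \<partial>P)"
      by (subst joint) auto
    also have "\<dots> = (\<integral>\<^sup>+y. \<integral>\<^sup>+x. ennreal (normal_density 0 \<sigma> (y - s x)) * indicator A y \<partial>P \<partial>lborel)"
      by (rule PL.Fubini'[symmetric]) measurable
    also have "\<dots> = (\<integral>\<^sup>+y. ennreal (q y) * indicator A y \<partial>lborel)"
      by (intro nn_integral_cong, subst nn_integral_multc) (auto simp: q_nn)
    also have "\<dots> = emeasure (density lborel (\<lambda>y. ennreal (q y))) A"
      by (subst emeasure_density) auto
    finally show "emeasure (distr C lborel (channel_output n h)) A = \<dots>" .
  qed (auto simp: C_eq Y_eq)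
  have "channel_information n h \<sigma> P = C.mutual_information (exp 1) B borel fst (channel_output n h)"
    by (simp add: channel_information_def C_def B_def)
  \<comment> \<open>Mutual information sees only the sigma-algebras of the target measures, so these
    may be exchanged for the reference measures.\<close>
  also have "\<dots> = C.mutual_information (exp 1) P lborel fst (channel_output n h)"
  proof -
    have "distr C B fst = distr C P fst" by (rule distr_cong) (auto simp: sP)
    moreover have "distr C borel (channel_output n h) = distr C lborel (channel_output n h)"
      by (rule distr_cong) auto
    moreover have "distr C (B \<Otimes>\<^sub>M borel) (\<lambda>x. (fst x, channel_output n h x))
        = distr C (P \<Otimes>\<^sub>M lborel) (\<lambda>x. (fst x, channel_output n h x))"
      by (rule distr_cong) (auto intro!: sets_pair_measure_cong simp: sP)
    ultimately show ?thesis unfolding C.mutual_information_def by simp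
  qed
  also have "\<dots> = (\<integral>p. normal_density 0 \<sigma> (snd p - s (fst p)) *
      log (exp 1) (normal_density 0 \<sigma> (snd p - s (fst p)) / (1 * q (snd p))) \<partial>(P \<Otimes>\<^sub>M lborel))"
    by (rule C.mutual_information_distr[OF _ _ dX _ dY _ dXY])
       (auto intro: P.sigma_finite_measure_axioms lborel.sigma_finite_measure_axioms less_imp_le qpos)
  also have "\<dots> = (\<integral>p. log (exp 1) (normal_density 0 \<sigma> (channel_output n h p - s (fst p)) / (1 * q (channel_output n h p))) \<partial>C)"
    by (subst distributed_integral[OF dXY]) auto
  also have "\<dots> = (\<integral>p. ln (normal_density 0 \<sigma> (snd p)) - ln (q (s (fst p) + snd p)) \<partial>C)"
    unfolding Y_eq using qpos normal_density_pos[OF \<sigma>]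
    by (intro Bochner_Integration.integral_cong refl) (simp add: log_def ln_div less_imp_neq[THEN not_sym, OF qpos] less_imp_neq[THEN not_sym, OF normal_density_pos[OF \<sigma>]])
  also have "C = distr (std_gauss \<Otimes>\<^sub>M gauss_noise \<sigma>) (B \<Otimes>\<^sub>M gauss_noise \<sigma>) (\<lambda>(x, z). (\<xi> x, z))"
  proof -
    have "distr std_gauss B \<xi> \<Otimes>\<^sub>M distr (gauss_noise \<sigma>) (gauss_noise \<sigma>) (\<lambda>z. z)
      = distr (std_gauss \<Otimes>\<^sub>M gauss_noise \<sigma>) (B \<Otimes>\<^sub>M gauss_noise \<sigma>) (\<lambda>(x, z). (\<xi> x, z))"
      by (rule pair_measure_distr) (auto simp: distr_id N2.sigma_finite_measure_axioms)
    then show ?thesis by (simp add: C_eq P_def distr_id)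
  qed
  also have "(\<integral>p. ln (normal_density 0 \<sigma> (snd p)) - ln (q (s (fst p) + snd p))
      \<partial>distr (std_gauss \<Otimes>\<^sub>M gauss_noise \<sigma>) (B \<Otimes>\<^sub>M gauss_noise \<sigma>) (\<lambda>(x, z). (\<xi> x, z)))
    = (\<integral>p. ln (normal_density 0 \<sigma> (snd p)) - ln (q (S (fst p) + snd p)) \<partial>(std_gauss \<Otimes>\<^sub>M gauss_noise \<sigma>))"
    by (subst integral_distr) (auto simp: S_eq split_beta)
  finally show ?thesis by (simp add: P_def q_def B_def)
qed

text \<open>Stated for a minimiser, since the input law is built from its tilted density. The
  parameter \<open>m\<close> lets one argument serve both the full problem and the one with the
  first input removed.\<close>

lemma capacity_E_ge_of_minimizer:
  fixes n m :: nat and h \<alpha> lam :: "nat \<Rightarrow> real" and \<sigma> \<nu> :: real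
  assumes mn: "m < n" and h: "\<And>k. k \<in> {1..n} \<Longrightarrow> h k > 0" and h1: "cumH h n = 1"
    and anti: "\<And>j k. 1 \<le> j \<Longrightarrow> j \<le> k \<Longrightarrow> k \<le> n \<Longrightarrow> \<alpha> k \<le> \<alpha> j"
    and \<alpha>1: "\<And>k. k \<in> {1..m} \<Longrightarrow> \<alpha> k = 1" and \<sigma>: "\<sigma> > 0"
    and lam: "\<forall>i\<in>{m+1..<n}. 0 \<le> lam i"
    and min: "\<And>\<nu>' lam'. \<forall>i\<in>{m+1..<n}. 0 \<le> lam' i \<Longrightarrow>
      maxent_dual m n h \<alpha> \<nu> lam \<le> maxent_dual m n h \<alpha> \<nu>' lam'"
  shows "ereal (1 / 2 * ln (1 + exp (2 * maxent_dual m n h \<alpha> \<nu> lam) / (2 * pi * exp 1 * \<sigma>\<^sup>2)))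
    \<le> capacity_E n h \<alpha> \<sigma>"
proof -
  let ?a = "cumH h m" and ?c = "mean_tail n h \<alpha>"
  define \<gamma> where "\<gamma> = maxent_dual m n h \<alpha> \<nu> lam"
  define f where "f s = exp (log_tilt m n h \<nu> lam s)" for s
  note st = maxent_dual_stationary[OF mn h h1 lam min, folded f_def \<gamma>_def]
  interpret N1: prob_space std_gauss by (rule prob_space_normal_density) simp
  interpret N2: prob_space "gauss_noise \<sigma>" by (rule prob_space_normal_density) (rule \<sigma>)
  interpret P: pair_prob_space std_gauss "gauss_noise \<sigma>" ..
  have a01: "0 \<le> ?a" "?a < 1"
    using cumH_mono[where h=h and i=0 and j=m and n=n] cumH_strict_mono[where h=h and i=m and j=n and n=n] h mn h1
    by auto
  have contf: "continuous_on A f" for A unfolding f_def[abs_def] by (intro continuous_intros)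
  have fpos: "f s > 0" for s by (simp add: f_def)
  obtain T where T: "\<And>x. (T has_real_derivative std_normal_density x / f (T x)) (at x)"
    and rng: "range T = {?a<..<1}"
    using gauss_transport_exists[OF a01(2) contf fpos st(1)] by metis
  note expct = gauss_transport_expectation[OF contf fpos T rng]
  have Tin: "?a < T x" "T x < 1" for x using rng by (metis greaterThanLessThan_iff rangeI)+
  have T01: "0 \<le> T x" "T x \<le> 1" for x using Tin[of x] a01 by auto
  have contT: "continuous_on UNIV T"
    by (auto intro!: continuous_at_imp_continuous_on DERIV_isCont[OF T])
  have [measurable]: "T \<in> borel_measurable borel"
    using contT by (intro borel_measurable_continuous_onI)
  have tail: "N1.expectation (\<lambda>x. max 0 (T x - cumH h i))
      = integral {?a..1} (\<lambda>s. max 0 (s - cumH h i) * f s)" for i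
    by (rule expct) (intro continuous_intros)
  have intT: "integrable std_gauss T" by (rule expct) (intro continuous_intros)
  have meanT: "N1.expectation T = ?a + ?c m"
  proof -
    have "N1.expectation (\<lambda>x. max 0 (T x - ?a)) = N1.expectation (\<lambda>x. T x - ?a)"
      using Tin by (intro Bochner_Integration.integral_cong) (auto simp: max_def less_imp_le)
    also have "\<dots> = N1.expectation T - ?a" using intT by (simp add: N1.prob_space[simplified])
    finally show ?thesis using st(2) unfolding tail by simp
  qed
  \<comment> \<open>As the first \<open>m\<close> means are 1, a variable of the right mean that
    stays above \<open>cumH h m\<close> meets the constraints below \<open>m\<close> with
    equality.\<close>
  have head: "cumH h i + ?c i = ?a + ?c m" if "i \<le> m" for i
  proof -
    have s: "(\<Sum>k=i+1..m. h k * \<alpha> k) = (\<Sum>k=i+1..m. h k)"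
      using \<alpha>1 by (intro sum.cong) auto
    have "?c i = (\<Sum>k=i+1..m. h k * \<alpha> k) + ?c m"
      unfolding mean_tail_def using that mn sum.ub_add_nat[of "i+1" m "\<lambda>k. h k * \<alpha> k" "n - m"] by simp
    moreover have "?a = cumH h i + (\<Sum>k=i+1..m. h k)"
      unfolding cumH_def using that sum.ub_add_nat[of 1 i h "m - i"] by simp
    ultimately show ?thesis using s by simp
  qed
  have "\<exists>X. splits_into std_gauss n h T X \<and> (\<forall>k\<in>{1..n}. N1.expectation (X k) = \<alpha> k)"
  proof (rule N1.splits_into_exists[OF h h1 anti])
    show "T \<in> borel_measurable std_gauss" by measurable
    show "N1.expectation T = (\<Sum>k=1..n. h k * \<alpha> k)"
      using meanT head[of 0] by (simp add: mean_tail_def)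
    fix i assume i: "i \<le> n"
    have "N1.expectation (\<lambda>x. max 0 (T x - cumH h i)) \<le> ?c i"
    proof (cases "i < m")
      case True
      then have "cumH h i \<le> ?a" using mn h by (intro cumH_mono[where n=n]) auto
      then have "N1.expectation (\<lambda>x. max 0 (T x - cumH h i)) = N1.expectation (\<lambda>x. T x - cumH h i)"
        using Tin by (intro Bochner_Integration.integral_cong refl) (smt (verit, best) max.absorb2)
      also have "\<dots> = N1.expectation T - cumH h i" using intT by (simp add: N1.prob_space[simplified])
      finally show ?thesis using meanT head[of i] True by simp
    next
      case False
      show ?thesis
      proof (cases "i = n")
        case True
        have "(\<lambda>x. max 0 (T x - cumH h i)) = (\<lambda>x. 0)"
          using T01(2) h1 True by (intro ext max_absorb1) simp
        then show ?thesis using True by (simp add: mean_tail_def)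
      next
        case i': False
        then have "i \<in> {m..<n}" using False i by auto
        then show ?thesis unfolding tail using st(3)[of i] by simp
      qed
    qed
    then show "N1.expectation (\<lambda>x. max 0 (T x - cumH h i)) \<le> (\<Sum>k=i+1..n. h k * \<alpha> k)"
      by (simp add: mean_tail_def)
  qed (use T01 in auto)
  then obtain X where X: "splits_into std_gauss n h T X" and EX: "\<And>k. k \<in> {1..n} \<Longrightarrow> N1.expectation (X k) = \<alpha> k"
    by blast
  define B where "B = (\<Pi>\<^sub>M k\<in>{1..n}. (borel :: real measure))"
  define \<xi> where "\<xi> = (\<lambda>x. \<lambda>k\<in>{1..n}. X k x)"
  have Xm: "X k \<in> borel_measurable borel" if "k \<in> {1..n}" for k
    using X that unfolding splits_into_def by simp
  have \<xi>: "\<xi> \<in> borel \<rightarrow>\<^sub>M B"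
    unfolding \<xi>_def B_def by (rule measurable_restrict) (rule Xm)
  then have \<xi>': "\<xi> \<in> std_gauss \<rightarrow>\<^sub>M B"
    by (simp only: measurable_density_eq1 measurable_lborel2)
  have \<xi>sum: "(\<Sum>k=1..n. h k * \<xi> x k) = T x" for x
    using X unfolding splits_into_def by (simp add: \<xi>_def)
  define Q where "Q = distr std_gauss B \<xi>"
  have Q: "Q \<in> input_laws n \<alpha>"
    unfolding input_laws_def
  proof (intro CollectI conjI ballI)
    show "prob_space Q" unfolding Q_def by (rule N1.prob_space_distr[OF \<xi>'])
    show "sets Q = sets (\<Pi>\<^sub>M k\<in>{1..n}. (borel :: real measure))" by (simp add: Q_def B_def)
    fix k assume k: "k \<in> {1..n}"
    have comp: "(\<lambda>x. x k) \<in> borel_measurable B"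
      unfolding B_def using k by (rule measurable_component_singleton)
    show "AE x in Q. 0 \<le> x k \<and> x k \<le> 1"
      unfolding Q_def using X k comp unfolding splits_into_def
      by (subst AE_distr_iff[OF \<xi>']) (auto simp: \<xi>_def pred_def[symmetric])
    show "(\<integral>x. x k \<partial>Q) = \<alpha> k"
      unfolding Q_def using k EX[OF k] by (subst integral_distr[OF \<xi>' comp]) (simp add: \<xi>_def)
  qed
  let ?M = "std_gauss \<Otimes>\<^sub>M gauss_noise \<sigma>"
  define T' where "T' x = std_normal_density x / f (T x)" for x
  have contT': "continuous_on UNIV T'"
    unfolding T'_def[abs_def] using fpos
    by (intro continuous_on_divide continuous_on_compose2[OF contf[of UNIV] contT])
       (auto simp: normal_density_def less_imp_neq[THEN not_sym] intro!: continuous_intros)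
  have T'pos: "T' x > 0" for x
    unfolding T'_def using fpos normal_density_pos by (intro divide_pos_pos) auto
  have lnT': "ln (T' x) = - (ln (2 * pi) / 2) - x\<^sup>2 / 2 - log_tilt m n h \<nu> lam (T x)" for x
    using normal_density_pos[of 1 0 x] ln_normal_density[of 1 x]
    unfolding T'_def f_def by (subst ln_div) auto
  note mom1 = gauss_noise_moments[OF zero_less_one] and mom2 = gauss_noise_moments[OF \<sigma>]
  have tilt: "integrable std_gauss (\<lambda>x. log_tilt m n h \<nu> lam (T x))"
    "N1.expectation (\<lambda>x. log_tilt m n h \<nu> lam (T x)) = - \<gamma>"
    using expct[OF continuous_on_log_tilt[of UNIV m n h \<nu> lam]] st(4) by simp_all
  have int_lnT': "integrable std_gauss (\<lambda>x. ln (T' x))"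
    unfolding lnT' using tilt(1) mom1(3) by simp
  \<comment> \<open>For an increasing map the mean of \<open>ln T'\<close> is the gain in
    differential entropy: \<open>\<gamma>\<close> for the image, minus
    \<open>ln (2 * pi) / 2 + 1 / 2\<close> for the standard Gaussian.\<close>
  have E_lnT': "N1.expectation (\<lambda>x. ln (T' x)) = \<gamma> - ln (2 * pi) / 2 - 1 / 2"
    unfolding lnT' using tilt mom1(3,4) by (simp add: N1.prob_space[simplified])
  define \<tau> where "\<tau> = exp (N1.expectation (\<lambda>x. ln (T' x)))"
  have \<tau>2: "\<tau>\<^sup>2 = exp (2 * \<gamma>) / (2 * pi * exp 1)"
  proof -
    have "\<tau>\<^sup>2 = exp (2 * \<gamma> - ln (2 * pi) - 1)"
      unfolding \<tau>_def E_lnT' by (simp add: exp_double[symmetric] algebra_simps)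
    also have "\<dots> = exp (2 * \<gamma>) / (2 * pi) / exp 1"
      by (simp only: exp_diff) simp
    finally show ?thesis by simp
  qed
  have epi: "integrable ?M (\<lambda>p. ln (out_density \<sigma> T (T (fst p) + snd p)))"
    "(\<integral>p. ln (out_density \<sigma> T (T (fst p) + snd p)) \<partial>?M)
      \<le> - (ln (2 * pi) / 2) - 1 / 2 - ln (\<tau>\<^sup>2 + \<sigma>\<^sup>2) / 2"
    using gauss_entropy_power[OF \<sigma> T[folded T'_def] contT' T'pos T01 int_lnT' \<tau>_def] by blast+
  have noise: "integrable ?M (\<lambda>p. ln (normal_density 0 \<sigma> (snd p)))"
    "(\<integral>p. ln (normal_density 0 \<sigma> (snd p)) \<partial>?M) = - (ln (2 * pi) / 2) - ln \<sigma> - 1 / 2"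
  proof -
    have i: "integrable (gauss_noise \<sigma>) (\<lambda>z. ln (normal_density 0 \<sigma> z))"
      unfolding ln_normal_density[OF \<sigma>] using mom2(3) by simp
    have "(\<integral>z. ln (normal_density 0 \<sigma> z) \<partial>gauss_noise \<sigma>) = - (ln (2 * pi) / 2) - ln \<sigma> - 1 / 2"
      unfolding ln_normal_density[OF \<sigma>] using mom2(3,4) \<sigma> by (simp add: N2.prob_space[simplified])
    then show "integrable ?M (\<lambda>p. ln (normal_density 0 \<sigma> (snd p)))"
      "(\<integral>p. ln (normal_density 0 \<sigma> (snd p)) \<partial>?M) = - (ln (2 * pi) / 2) - ln \<sigma> - 1 / 2"
      using P.integral_fst_snd(3,4)[OF i] by simp_all
  qed
  have "channel_information n h \<sigma> Q
      = (\<integral>p. ln (normal_density 0 \<sigma> (snd p)) - ln (out_density \<sigma> T (T (fst p) + snd p)) \<partial>?M)"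
    using channel_information_gauss_input[where \<xi>=\<xi> and h=h and n=n and \<sigma>=\<sigma>] \<sigma> \<xi> T01
    unfolding Q_def B_def \<xi>sum by simp
  \<comment> \<open>Output entropy minus noise entropy; the constants of the two Gaussian terms
    cancel.\<close>
  also have "\<dots> \<ge> ln (\<tau>\<^sup>2 + \<sigma>\<^sup>2) / 2 - ln \<sigma>"
    using epi noise by simp
  also have "ln (\<tau>\<^sup>2 + \<sigma>\<^sup>2) / 2 - ln \<sigma> = 1 / 2 * ln (1 + exp (2 * \<gamma>) / (2 * pi * exp 1 * \<sigma>\<^sup>2))"
  proof -
    have "1 + exp (2 * \<gamma>) / (2 * pi * exp 1 * \<sigma>\<^sup>2) = (\<tau>\<^sup>2 + \<sigma>\<^sup>2) / \<sigma>\<^sup>2"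
      using \<sigma> by (simp add: \<tau>2 add_divide_distrib)
    moreover have "\<tau>\<^sup>2 + \<sigma>\<^sup>2 > 0" using \<sigma> by (simp add: add_nonneg_pos)
    ultimately show ?thesis using \<sigma> by (simp add: ln_div ln_realpow)
  qed
  finally have "1 / 2 * ln (1 + exp (2 * \<gamma>) / (2 * pi * exp 1 * \<sigma>\<^sup>2)) \<le> channel_information n h \<sigma> Q" .
  then show ?thesis
    unfolding capacity_E_def \<gamma>_def[symmetric] by (intro SUP_upper2[OF Q]) simp
qed

theorem theorem3:
  fixes n :: nat and h \<alpha> :: "nat \<Rightarrow> real" and \<sigma> :: real
  assumes "n \<ge> 2"
    and "\<forall>k\<in>{1..n}. h k > 0"
    and "(\<Sum>k=1..n. h k) = 1"
    and "\<alpha> 1 \<le> 1"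
    and "\<forall>k\<in>{1..<n}. \<alpha> k > \<alpha> (k+1)"
    and "\<alpha> n > 0"
    and "\<alpha> n \<le> 1 / 2"
    and "\<sigma> > 0"
  shows "capacity_E n h \<alpha> \<sigma>
           \<ge> ereal (1 / 2 * ln (1 + exp (2 * gamma_E n h \<alpha>) / (2 * pi * exp 1 * \<sigma>\<^sup>2)))
         \<and> (\<alpha> 1 < 1 \<longrightarrow> (\<exists>p. is_arg_min (dual_objective n h \<alpha>) (dual_feasible n) p))"
proof -
  note n = assms(1) and \<sigma> = assms(8)
  have h: "h k > 0" if "k \<in> {1..n}" for k using assms(2) that by blast
  have h1: "cumH h n = 1" using assms(3) by (simp add: cumH_def)
  have anti: "\<alpha> k \<le> \<alpha> j" if "1 \<le> j" "j \<le> k" "k \<le> n" for j k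
    using that(2,1,3)
  proof (induction rule: dec_induct)
    case (step k)
    then have "\<alpha> (k + 1) < \<alpha> k" using assms(5) by auto
    then show ?case using step by simp
  qed simp
  have \<alpha>pos: "\<alpha> k > 0" if "k \<in> {1..n}" for k
    using anti[of k n] assms(6) that by auto
  have \<alpha>2: "\<alpha> k < \<alpha> 1" if "k \<in> {2..n}" for k
    using anti[of 2 k] bspec[OF assms(5), of 1] n that by (auto simp: numeral_2_eq_2)
  have dual: "dual_objective n h \<alpha> p = maxent_dual 0 n h \<alpha> (fst p) (snd p)" for p
    using dual_objective_eq_maxent_dual[of n h \<alpha> "fst p" "snd p"] h h1 n by simp
  have feas: "dual_feasible n p \<longleftrightarrow> (\<forall>i\<in>{1..<n}. 0 \<le> snd p i)" for p
    using n by (cases p) (auto simp: dual_feasible_def)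
  have gamma: "gamma_E n h \<alpha> = (INF p\<in>{p. \<forall>i\<in>{1..<n}. 0 \<le> snd p i}. maxent_dual 0 n h \<alpha> (fst p) (snd p))"
    unfolding gamma_E_def dual feas ..
  have mono: "ereal (1 / 2 * ln (1 + exp (2 * x) / (2 * pi * exp 1 * \<sigma>\<^sup>2)))
      \<le> ereal (1 / 2 * ln (1 + exp (2 * y) / (2 * pi * exp 1 * \<sigma>\<^sup>2)))" if "x \<le> y" for x y :: real
  proof -
    have "exp (2 * x) / (2 * pi * exp 1 * \<sigma>\<^sup>2) \<le> exp (2 * y) / (2 * pi * exp 1 * \<sigma>\<^sup>2)"
      using that by (intro divide_right_mono) auto
    moreover have "0 < 1 + exp (2 * x) / (2 * pi * exp 1 * \<sigma>\<^sup>2)" by (intro add_pos_nonneg) auto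
    ultimately have "ln (1 + exp (2 * x) / (2 * pi * exp 1 * \<sigma>\<^sup>2))
        \<le> ln (1 + exp (2 * y) / (2 * pi * exp 1 * \<sigma>\<^sup>2))" by (intro ln_mono) auto
    then show ?thesis by simp
  qed
  consider (less) "\<alpha> 1 < 1" | (one) "\<alpha> 1 = 1" using assms(4) by linarith
  then show ?thesis
  proof cases
    case less
    have \<alpha>lt: "\<alpha> k < 1" if "k \<in> {0+1..n}" for k using anti[of 1 k] less that by auto
    obtain \<nu> lam where lam: "\<forall>i\<in>{0+1..<n}. 0 \<le> lam i"
      and min: "\<And>\<nu>' lam'. \<forall>i\<in>{0+1..<n}. 0 \<le> lam' i \<Longrightarrow>
        maxent_dual 0 n h \<alpha> \<nu> lam \<le> maxent_dual 0 n h \<alpha> \<nu>' lam'"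
      by (rule maxent_dual_attained[of 0 n h \<alpha>]) (use n h h1 \<alpha>pos \<alpha>lt in auto)
    have "gamma_E n h \<alpha> \<le> maxent_dual 0 n h \<alpha> (fst (\<nu>, lam)) (snd (\<nu>, lam))"
      unfolding gamma
      by (rule cINF_lower) (use lam min in \<open>auto intro!: bdd_belowI2[where m="maxent_dual 0 n h \<alpha> \<nu> lam"]\<close>)
    then have "ereal (1 / 2 * ln (1 + exp (2 * gamma_E n h \<alpha>) / (2 * pi * exp 1 * \<sigma>\<^sup>2))) \<le>
        ereal (1 / 2 * ln (1 + exp (2 * maxent_dual 0 n h \<alpha> \<nu> lam) / (2 * pi * exp 1 * \<sigma>\<^sup>2)))"
      by (intro mono) simp
    also have "\<dots> \<le> capacity_E n h \<alpha> \<sigma>"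
      by (rule capacity_E_ge_of_minimizer[OF _ h h1 anti _ \<sigma> lam min]) (use n in auto)
    finally have "ereal (1 / 2 * ln (1 + exp (2 * gamma_E n h \<alpha>) / (2 * pi * exp 1 * \<sigma>\<^sup>2))) \<le> capacity_E n h \<alpha> \<sigma>" .
    moreover have "is_arg_min (dual_objective n h \<alpha>) (dual_feasible n) (\<nu>, lam)"
      unfolding is_arg_min_linorder dual feas using lam min by simp
    ultimately show ?thesis by blast
  next
    case one
    have \<alpha>lt: "\<alpha> k < 1" if "k \<in> {1+1..n}" for k using \<alpha>2[of k] one that by auto
    obtain \<nu> lam where lam: "\<forall>i\<in>{1+1..<n}. 0 \<le> lam i"
      and min: "\<And>\<nu>' lam'. \<forall>i\<in>{1+1..<n}. 0 \<le> lam' i \<Longrightarrow>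
        maxent_dual 1 n h \<alpha> \<nu> lam \<le> maxent_dual 1 n h \<alpha> \<nu>' lam'"
      by (rule maxent_dual_attained[of 1 n h \<alpha>]) (use n h h1 \<alpha>pos \<alpha>lt in auto)
    let ?D = "maxent_dual 1 n h \<alpha> \<nu> lam"
    \<comment> \<open>A real-valued \<open>INF\<close> is the infimum only for a set bounded below;
      the minimum of the reduced problem supplies the bound.\<close>
    have bdd: "bdd_below ((\<lambda>p. maxent_dual 0 n h \<alpha> (fst p) (snd p)) ` {p. \<forall>i\<in>{1..<n}. 0 \<le> snd p i})"
    proof (rule bdd_belowI2[where m="?D"])
      fix p :: "real \<times> (nat \<Rightarrow> real)" assume p: "p \<in> {p. \<forall>i\<in>{1..<n}. 0 \<le> snd p i}"
      have "?D \<le> maxent_dual 1 n h \<alpha> (fst p - snd p 0 * h 1) ((snd p)(1 := snd p 0 + snd p 1))"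
        by (rule min) (use p in auto)
      also have "\<dots> \<le> maxent_dual 0 n h \<alpha> (fst p) (snd p)"
        using n h h1 one by (rule maxent_dual_1_le_maxent_dual_0)
      finally show "?D \<le> maxent_dual 0 n h \<alpha> (fst p) (snd p)" .
    qed
    \<comment> \<open>In the reduced problem \<open>lam 1\<close> has no sign constraint, in the
      full one it must be nonnegative: hence \<open>t \<ge> \<bar>lam 1\<bar>\<close>. The term
      \<open>exp \<nu> / t\<close> bounds the integral over the first cell and vanishes as
      \<open>t\<close> grows.\<close>
    have le: "gamma_E n h \<alpha> \<le> ?D + exp \<nu> / t" if t: "t > 0" "t \<ge> \<bar>lam 1\<bar>" for t
    proof -
      let ?l = "lam(0 := - t, 1 := lam 1 + t)"
      have "\<forall>i\<in>{1..<n}. 0 \<le> ?l i" using lam t by auto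
      then have "gamma_E n h \<alpha> \<le> maxent_dual 0 n h \<alpha> (fst (\<nu> - t * h 1, ?l)) (snd (\<nu> - t * h 1, ?l))"
        unfolding gamma by (intro cINF_lower[OF bdd]) simp
      also have "\<dots> \<le> ?D + exp \<nu> / t"
        unfolding fst_conv snd_conv using n h h1 one t(1) refl by (rule maxent_dual_1_le_maxent_dual_0)
      finally show ?thesis .
    qed
    have "gamma_E n h \<alpha> \<le> ?D"
    proof (rule field_le_epsilon)
      fix e :: real assume e: "e > 0"
      define t where "t = max (\<bar>lam 1\<bar>) (exp \<nu> / e)"
      have t: "t > 0" "t \<ge> \<bar>lam 1\<bar>" "t \<ge> exp \<nu> / e" using e by (auto simp: t_def less_max_iff_disj)
      then have "exp \<nu> / t \<le> e" using e by (simp add: field_simps)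
      then show "gamma_E n h \<alpha> \<le> ?D + e" using le[OF t(1,2)] by linarith
    qed
    then have "ereal (1 / 2 * ln (1 + exp (2 * gamma_E n h \<alpha>) / (2 * pi * exp 1 * \<sigma>\<^sup>2))) \<le>
        ereal (1 / 2 * ln (1 + exp (2 * ?D) / (2 * pi * exp 1 * \<sigma>\<^sup>2)))"
      by (rule mono)
    also have "\<dots> \<le> capacity_E n h \<alpha> \<sigma>"
      by (rule capacity_E_ge_of_minimizer[OF _ h h1 anti _ \<sigma> lam min]) (use n one in auto)
    finally show ?thesis using one by simp
  qed
qed

end
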